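(* Let $\mathbb U\subset\mathbb R^D$ and a weight $W$ on $\mathbb U$ with $\int_{\mathbb U}W(\mathbf x)\,d\mathbf x=1$ be such that $L^2(\mathbb U,W)$ has an orthogonal basis of polynomials and the reproducing kernels of the spaces $\mathcal V_n(\mathbb U,W)$ satisfy an addition formula with weight $\varpi$ on $[-1,1]$. Let $p,q,r\ge1$ with $p^{-1}=r^{-1}+q^{-1}-1$. For $f\in L^q(\mathbb U,W)$ and $g\in L^r([-1,1],\varpi)$ with $g$ an even function, $$\|f\ast g\|_{L^p(\mathbb U,W)}\le\|f\|_{L^q(\mathbb U,W)}\,\|g\|_{L^r([-1,1],\varpi)} .$$
   Context: $\mathcal V_n(\mathbb U,W)$ is the space of orthogonal polynomials of degree $n$ in $L^2(\mathbb U,W)$, with inner product $\int_{\mathbb U}fgW\,d\mathbf x$; here $d\mathbf x$ is Lebesgue measure, or the surface measure if $\mathbb U$ is a surface. $P_n(\cdot,\cdot)$ is the reproducing kernel of $\mathcal V_n(\mathbb U,W)$. The kernels $P_n$ are said to satisfy an addition formula if there is a weight function $\varpi$ on $[-1,1]$ with $\int_{-1}^1\varpi(t)\,dt=1$ such that, for all $n\ge0$, $$P_n(\mathbf x,\mathbf y)=\int_{[-1,1]^m}Z_n\big(\xi(\mathbf x,\mathbf y;\mathbf u)\big)\,d\tau(\mathbf u),\qquad Z_n(t)=\frac{p_n(\varpi;1)\,p_n(\varpi;t)}{h_n(\varpi)}.$$ Here $m$ is a positive integer; $\xi(\mathbf x,\mathbf y;\mathbf u)\in[-1,1]$ is a (measurable)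 function, symmetric in $\mathbf x$ and $\mathbf y$; $\tau$ is a probability measure on $[-1,1]^m$ (possibly of finite support); $p_n(\varpi;\cdot)$ is an orthogonal polynomial of degree $n$ with respect to $\varpi$ on $[-1,1]$, and $h_n(\varpi)=\int_{-1}^1p_n(\varpi;t)^2\varpi(t)\,dt$. For $g\in L^1([-1,1],\varpi)$ define $Tg(\mathbf x,\mathbf y)=\int_{[-1,1]^m}g(\xi(\mathbf x,\mathbf y;\mathbf u))\,d\tau(\mathbf u)$. For $f\in L^1(\mathbb U,W)$ define the convolution $(f\ast g)(\mathbf x)=\int_{\mathbb U}f(\mathbf y)\,Tg(\mathbf x,\mathbf y)\,W(\mathbf y)\,d\mathbf y$. Norms in $L^p(\mathbb U,W)$ and $L^r([-1,1],\varpi)$ are taken with respect to $W\,d\mathbf x$ and $\varpi\,dt$. *)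

theory Defs
  imports "HOL-Probability.Probability"
begin

section \<open>Lebesgue and surface measure\<close>

text \<open>
  The \<open>k\<close>-dimensional Hausdorff measure, with the constant for which a set of diameter \<open>d\<close>
  is charged with the volume of the \<open>k\<close>-dimensional ball of that diameter.  On a smooth
  \<open>k\<close>-dimensional surface it is the usual surface area (and arc length for \<open>k = 1\<close>).
  Covering sets have to be bounded explicitly, because \<^const>\<open>diameter\<close> is a
  real-valued supremum without meaning on unbounded sets.  The conditional makes the empty set
  free also for \<open>k = 0\<close>, where \<open>0 ^ 0 = 1\<close>.
\<close>

definition hausdorff_premeasure :: "nat \<Rightarrow> real \<Rightarrow> 'a::metric_space set \<Rightarrow> ennreal" where
  "hausdorff_premeasure k \<delta> A =
     (INF C \<in> {C :: nat \<Rightarrow> 'a set.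
                 A \<subseteq> (\<Union>i. C i) \<and> (\<forall>i. bounded (C i) \<and> diameter (C i) \<le> \<delta>)}.
        \<Sum>i. if C i = {} then 0
             else ennreal (unit_ball_vol (real k) * (diameter (C i) / 2) ^ k))"

definition hausdorff_outer_measure :: "nat \<Rightarrow> 'a::metric_space set \<Rightarrow> ennreal" where
  "hausdorff_outer_measure k A = (SUP \<delta> \<in> {0<..}. hausdorff_premeasure k \<delta> A)"

text \<open>
  The Hausdorff outer measure is a metric outer measure, hence countably additive on the Borel
  sets, so the following is its restriction to the Borel sets.
\<close>

definition hausdorff_measure :: "nat \<Rightarrow> 'a::metric_space measure" where
  "hausdorff_measure k = measure_of UNIV (sets borel) (hausdorff_outer_measure k)"

text \<open>
  The admissible interpretations of \<open>dx\<close> on \<open>U\<close>: Lebesgue measure, or the surface measure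
  of a \<open>k\<close>-dimensional surface, given by the \<open>k\<close>-dimensional Hausdorff measure.
\<close>

definition volume_or_surface_measure ::
  "(real ^ 'd) set \<Rightarrow> (real ^ 'd) measure \<Rightarrow> bool" where
  "volume_or_surface_measure U \<sigma> \<longleftrightarrow>
     \<sigma> = restrict_space lborel U \<or>
     (\<exists>k < CARD('d). \<sigma> = restrict_space (hausdorff_measure k) U)"

text \<open>A nonnegative density of total mass one.\<close>

definition unit_weight :: "'a measure \<Rightarrow> ('a \<Rightarrow> real) \<Rightarrow> bool" where
  "unit_weight \<sigma> W \<longleftrightarrow>
     (\<forall>x \<in> space \<sigma>. 0 \<le> W x) \<and> has_bochner_integral \<sigma> W 1"

definition weighted :: "'a measure \<Rightarrow> ('a \<Rightarrow> real) \<Rightarrow> 'a measure" where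
  "weighted \<sigma> W = density \<sigma> (\<lambda>x. ennreal (W x))"

section \<open>Lebesgue spaces\<close>

text \<open>The exponent ranges over \<open>[1, \<infinity>]\<close>; elements are functions, not equivalence classes.\<close>

definition Lp_space :: "'a measure \<Rightarrow> ereal \<Rightarrow> ('a \<Rightarrow> real) set" where
  "Lp_space M p =
     {f \<in> borel_measurable M.
        if p = \<infinity> then esssup M (\<lambda>x. ereal \<bar>f x\<bar>) < \<infinity>
        else integrable M (\<lambda>x. \<bar>f x\<bar> powr real_of_ereal p)}"

definition Lp_norm :: "'a measure \<Rightarrow> ereal \<Rightarrow> ('a \<Rightarrow> real) \<Rightarrow> real" where
  "Lp_norm M p f =
     (if p = \<infinity> then real_of_ereal (esssup M (\<lambda>x. ereal \<bar>f x\<bar>))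
      else (\<integral>x. \<bar>f x\<bar> powr real_of_ereal p \<partial>M) powr (1 / real_of_ereal p))"

section \<open>Orthogonal polynomials in several variables\<close>

text \<open>Polynomial functions of total degree at most \<open>n\<close>, written in the monomial basis.\<close>

definition polynomials_upto :: "nat \<Rightarrow> (real ^ 'd \<Rightarrow> real) set" where
  "polynomials_upto n =
     {P. \<exists>c :: ('d \<Rightarrow> nat) \<Rightarrow> real.
           P = (\<lambda>x. \<Sum>\<alpha> | sum \<alpha> UNIV \<le> n. c \<alpha> * (\<Prod>i\<in>UNIV. (x $ i) ^ \<alpha> i))}"

definition weighted_inner ::
  "'a measure \<Rightarrow> ('a \<Rightarrow> real) \<Rightarrow> ('a \<Rightarrow> real) \<Rightarrow> ('a \<Rightarrow> real) \<Rightarrow> real" where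
  "weighted_inner \<sigma> W f g = (\<integral>x. f x * g x * W x \<partial>\<sigma>)"

definition orthogonal_polynomials ::
  "(real ^ 'd) measure \<Rightarrow> (real ^ 'd \<Rightarrow> real) \<Rightarrow> nat \<Rightarrow> (real ^ 'd \<Rightarrow> real) set" where
  "orthogonal_polynomials \<sigma> W n =
     {P \<in> polynomials_upto n.
        \<forall>k < n. \<forall>Q \<in> polynomials_upto k. weighted_inner \<sigma> W P Q = 0}"

text \<open>
  An orthogonal basis is an orthogonal system of nonzero elements with dense linear span.
  All polynomials are required to be square integrable, as is implicit in regarding
  the orthogonal polynomials of degree \<open>n\<close> as a subspace of \<open>L\<^sup>2\<close>.
\<close>

definition has_orthogonal_polynomial_basis ::
  "(real ^ 'd) measure \<Rightarrow> (real ^ 'd \<Rightarrow> real) \<Rightarrow> bool" where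
  "has_orthogonal_polynomial_basis \<sigma> W \<longleftrightarrow>
     (\<forall>n. polynomials_upto n \<subseteq> Lp_space (weighted \<sigma> W) 2) \<and>
     (\<exists>B \<subseteq> (\<Union>n. polynomials_upto n).
        (\<forall>b\<in>B. weighted_inner \<sigma> W b b \<noteq> 0) \<and>
        (\<forall>b\<in>B. \<forall>b'\<in>B. b \<noteq> b' \<longrightarrow> weighted_inner \<sigma> W b b' = 0) \<and>
        (\<forall>f \<in> Lp_space (weighted \<sigma> W) 2. \<forall>\<epsilon>>0. \<exists>F c. finite F \<and> F \<subseteq> B \<and>
           Lp_norm (weighted \<sigma> W) 2 (\<lambda>x. f x - (\<Sum>b\<in>F. c b * b x)) < \<epsilon>))"

text \<open>
  The domain is \<open>space \<sigma>\<close>.  Elements of the space of orthogonal polynomials are given as polynomials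
  on the ambient space, but only their values on the domain matter: \<open>K x\<close> has
  to coincide there with such a polynomial.
\<close>

definition reproducing_kernel ::
  "(real ^ 'd) measure \<Rightarrow> (real ^ 'd \<Rightarrow> real) \<Rightarrow> nat \<Rightarrow> (real ^ 'd \<Rightarrow> real ^ 'd \<Rightarrow> real) \<Rightarrow> bool"
where
  "reproducing_kernel \<sigma> W n K \<longleftrightarrow>
     (\<forall>x \<in> space \<sigma>.
        (\<exists>P \<in> orthogonal_polynomials \<sigma> W n. \<forall>y \<in> space \<sigma>. K x y = P y) \<and>
        (\<forall>Q \<in> orthogonal_polynomials \<sigma> W n. weighted_inner \<sigma> W (K x) Q = Q x))"

section \<open>Addition formula and convolution\<close>

abbreviation lborel_11 :: "real measure" where
  "lborel_11 \<equiv> restrict_space lborel {-1..1}"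

definition orthogonal_poly :: "(real \<Rightarrow> real) \<Rightarrow> nat \<Rightarrow> real poly \<Rightarrow> bool" where
  "orthogonal_poly \<omega> n p \<longleftrightarrow>
     p \<noteq> 0 \<and> degree p = n \<and>
     (\<forall>q. degree q < n \<longrightarrow> weighted_inner lborel_11 \<omega> (poly p) (poly q) = 0)"

text \<open>\<open>p\<^sub>n(1) p\<^sub>n(t) / h\<^sub>n\<close>, which does not depend on the normalization of \<open>p\<^sub>n\<close>.\<close>

definition zonal :: "(real \<Rightarrow> real) \<Rightarrow> real poly \<Rightarrow> real \<Rightarrow> real" where
  "zonal \<omega> p t = poly p 1 * poly p t / weighted_inner lborel_11 \<omega> (poly p) (poly p)"

definition cube :: "(real ^ 'm) set" where
  "cube = {u. \<forall>i. u $ i \<in> {-1..1}}"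

definition addition_formula ::
  "(real ^ 'd) measure \<Rightarrow> (nat \<Rightarrow> real ^ 'd \<Rightarrow> real ^ 'd \<Rightarrow> real) \<Rightarrow> (real \<Rightarrow> real) \<Rightarrow>
   (real ^ 'd \<Rightarrow> real ^ 'd \<Rightarrow> real ^ 'm \<Rightarrow> real) \<Rightarrow> (real ^ 'm) measure \<Rightarrow> bool" where
  "addition_formula \<sigma> K \<omega> \<xi> \<tau> \<longleftrightarrow>
     unit_weight lborel_11 \<omega> \<and>
     prob_space \<tau> \<and> space \<tau> = cube \<and> sets \<tau> = sets (restrict_space borel cube) \<and>
     (\<lambda>(x, y, u). \<xi> x y u) \<in> borel_measurable (\<sigma> \<Otimes>\<^sub>M \<sigma> \<Otimes>\<^sub>M \<tau>) \<and>
     (\<forall>x \<in> space \<sigma>. \<forall>y \<in> space \<sigma>. \<forall>u \<in> cube.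
        \<xi> x y u \<in> {-1..1} \<and> \<xi> x y u = \<xi> y x u) \<and>
     (\<exists>p. \<forall>n. orthogonal_poly \<omega> n (p n) \<and>
        (\<forall>x \<in> space \<sigma>. \<forall>y \<in> space \<sigma>. K n x y = (\<integral>u. zonal \<omega> (p n) (\<xi> x y u) \<partial>\<tau>)))"

definition T_op ::
  "('a \<Rightarrow> 'a \<Rightarrow> 'u \<Rightarrow> real) \<Rightarrow> 'u measure \<Rightarrow> (real \<Rightarrow> real) \<Rightarrow> 'a \<Rightarrow> 'a \<Rightarrow> real" where
  "T_op \<xi> \<tau> g x y = (\<integral>u. g (\<xi> x y u) \<partial>\<tau>)"

definition kernel_convolution ::
  "'a measure \<Rightarrow> ('a \<Rightarrow> real) \<Rightarrow> ('a \<Rightarrow> 'a \<Rightarrow> 'u \<Rightarrow> real) \<Rightarrow> 'u measure \<Rightarrow>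
   ('a \<Rightarrow> real) \<Rightarrow> (real \<Rightarrow> real) \<Rightarrow> 'a \<Rightarrow> real" where
  "kernel_convolution \<sigma> W \<xi> \<tau> f g x = (\<integral>y. f y * T_op \<xi> \<tau> g x y * W y \<partial>\<sigma>)"

text \<open>
  Bochner integrals of non-integrable functions are \<open>0\<close>.  The following says that the two integrals
  defining the convolution at \<open>x\<close> genuinely converge.
\<close>

definition convolution_exists ::
  "'a measure \<Rightarrow> ('a \<Rightarrow> real) \<Rightarrow> ('a \<Rightarrow> 'a \<Rightarrow> 'u \<Rightarrow> real) \<Rightarrow> 'u measure \<Rightarrow>
   ('a \<Rightarrow> real) \<Rightarrow> (real \<Rightarrow> real) \<Rightarrow> 'a \<Rightarrow> bool" where
  "convolution_exists \<sigma> W \<xi> \<tau> f g x \<longleftrightarrow>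
     (AE y in weighted \<sigma> W. integrable \<tau> (\<lambda>u. g (\<xi> x y u))) \<and>
     integrable \<sigma> (\<lambda>y. f y * T_op \<xi> \<tau> g x y * W y)"

end

theory Submission
  imports Defs
begin

text \<open>
  For fixed \<open>x\<close>, integrating the zonal polynomials of positive degree over the probability measure
  \<open>W dy \<otimes> \<tau>\<close> along \<open>(y, u) \<mapsto> \<xi> x y u\<close> gives \<open>0\<close>, because \<open>P\<^sub>n(x, \<cdot>)\<close> is orthogonal to the
  constants.  Since \<open>p\<^sub>n(1) \<noteq> 0\<close>, the image of that measure has the same moments as \<open>\<varpi> dt\<close>, and
  therefore equals it.  By symmetry of \<open>\<xi>\<close> the same holds with \<open>x\<close> and \<open>y\<close> exchanged, so that the
  classical proof of Young's inequality by Hoelder's inequality for three functions applies.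
\<close>

section \<open>Hoelder's inequality and Lebesgue spaces\<close>

text \<open>The equality of image measures replaces the translation invariance behind Young's
  inequality on a group: averages along \<open>\<xi>\<close> do not depend on the fixed point. The
  addition formula gives such invariance for polynomials only, whereas \<open>g\<close> is merely
  measurable and matters only up to null sets. This is why equality of measures, and not just of
  polynomial integrals, is established; it comes from Weierstrass approximation on a compact
  interval and uniqueness of characteristic functions. Nonvanishing at 1 is what makes every moment
  recoverable: if the n-th orthogonal polynomial vanished at 1, the n-th zonal polynomial would be
  identically zero and the addition formula of degree n would carry no information about
  \<open>\<omega>\<close>. It holds because a root at an endpoint could be divided out without
  creating a sign change of the remaining weight. An infinite \<open>q\<close> or \<open>r\<close>
  leaves no power to factor. It forces the other of the two to be 1 and \<open>p\<close> to be
  infinite, and a direct bound replaces the Hoelder argument.\<close>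

lemma weighted_am_gm3:
  fixes a b c \<alpha> \<beta> \<gamma> :: real
  assumes "0 \<le> a" "0 \<le> b" "0 \<le> c" "0 \<le> \<alpha>" "0 \<le> \<beta>" "0 \<le> \<gamma>" "\<alpha> + \<beta> + \<gamma> = 1"
  shows "a powr \<alpha> * b powr \<beta> * c powr \<gamma> \<le> \<alpha> * a + \<beta> * b + \<gamma> * c"
proof (cases "a = 0 \<or> b = 0 \<or> c = 0")
  case True
  then show ?thesis
    using assms by auto
next
  case False
  then have pos: "a > 0" "b > 0" "c > 0"
    using assms by auto
  define m where "m = \<alpha> * a + \<beta> * b + \<gamma> * c"
  have "\<alpha> > 0 \<or> \<beta> > 0 \<or> \<gamma> > 0"
    using assms by linarith
  then have m: "m > 0"
    unfolding m_def using pos assms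
    by (smt (verit) mult_nonneg_nonneg mult_pos_pos)
  \<comment> \<open>Tangent to \<open>ln\<close> at the weighted mean \<open>m\<close>: averaging
    the three bounds with weights of sum 1 cancels the linear terms and leaves
    \<open>ln m\<close>.\<close>
  have ln_le: "ln x \<le> ln m + x / m - 1" if "x > 0" for x
    using ln_le_minus_one[of "x / m"] that m by (simp add: ln_div)
  have "\<alpha> * ln a + \<beta> * ln b + \<gamma> * ln c
      \<le> \<alpha> * (ln m + a / m - 1) + \<beta> * (ln m + b / m - 1) + \<gamma> * (ln m + c / m - 1)"
    by (intro add_mono mult_left_mono ln_le pos assms)
  also have "\<dots> = (\<alpha> + \<beta> + \<gamma>) * (ln m - 1) + (\<alpha> * a + \<beta> * b + \<gamma> * c) / m"
    by (simp add: algebra_simps add_divide_distrib)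
  also have "\<dots> = ln m"
    using m assms(7) by (simp flip: m_def)
  finally have "exp (\<alpha> * ln a + \<beta> * ln b + \<gamma> * ln c) \<le> exp (ln m)"
    by simp
  then show ?thesis
    using pos m by (simp add: powr_def exp_add m_def)
qed

text \<open>
  Zero exponents cause no exception: \<open>0 powr 0 = 0\<close>, so that both sides vanish as soon as one of
  the three functions is zero almost everywhere.
\<close>

lemma Hoelder3:
  fixes F G H :: "'a \<Rightarrow> real"
  assumes int: "integrable M F" "integrable M G" "integrable M H"
    and nonneg: "\<And>x. 0 \<le> F x" "\<And>x. 0 \<le> G x" "\<And>x. 0 \<le> H x"
    and exps: "0 \<le> \<alpha>" "0 \<le> \<beta>" "0 \<le> \<gamma>" "\<alpha> + \<beta> + \<gamma> = 1"
  shows "integrable M (\<lambda>x. F x powr \<alpha> * G x powr \<beta> * H x powr \<gamma>)"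
    and "(\<integral>x. F x powr \<alpha> * G x powr \<beta> * H x powr \<gamma> \<partial>M)
      \<le> (\<integral>x. F x \<partial>M) powr \<alpha> * (\<integral>x. G x \<partial>M) powr \<beta> * (\<integral>x. H x \<partial>M) powr \<gamma>"
proof -
  have [measurable]: "F \<in> borel_measurable M" "G \<in> borel_measurable M" "H \<in> borel_measurable M"
    using int by auto
  have int_bound: "integrable M (\<lambda>x. \<alpha> * F x + \<beta> * G x + \<gamma> * H x)"
    using int by auto
  show *: "integrable M (\<lambda>x. F x powr \<alpha> * G x powr \<beta> * H x powr \<gamma>)"
  proof (rule Bochner_Integration.integrable_bound[OF int_bound])
    show "AE x in M. norm (F x powr \<alpha> * G x powr \<beta> * H x powr \<gamma>) \<le> norm (\<alpha> * F x + \<beta> * G x + \<gamma> * H x)"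
      using weighted_am_gm3[OF nonneg exps]
      by (intro always_eventually allI) (smt (verit) real_norm_def mult_nonneg_nonneg powr_ge_zero)
  qed measurable
  define a b c where "a = (\<integral>x. F x \<partial>M)" and "b = (\<integral>x. G x \<partial>M)" and "c = (\<integral>x. H x \<partial>M)"
  have abc: "a \<ge> 0" "b \<ge> 0" "c \<ge> 0"
    unfolding a_def b_def c_def using nonneg by auto
  show "(\<integral>x. F x powr \<alpha> * G x powr \<beta> * H x powr \<gamma> \<partial>M)
      \<le> (\<integral>x. F x \<partial>M) powr \<alpha> * (\<integral>x. G x \<partial>M) powr \<beta> * (\<integral>x. H x \<partial>M) powr \<gamma>"
  proof (cases "a = 0 \<or> b = 0 \<or> c = 0")
    case True
    then have "(AE x in M. F x = 0) \<or> (AE x in M. G x = 0) \<or> (AE x in M. H x = 0)"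
      unfolding a_def b_def c_def using int nonneg by (simp add: integral_nonneg_eq_0_iff_AE)
    then have "AE x in M. F x powr \<alpha> * G x powr \<beta> * H x powr \<gamma> = 0"
      by auto
    then have "(\<integral>x. F x powr \<alpha> * G x powr \<beta> * H x powr \<gamma> \<partial>M) = 0"
      by (rule integral_eq_zero_AE)
    then show ?thesis
      by simp
  next
    case False
    then have pos: "a > 0" "b > 0" "c > 0"
      using abc by auto
    \<comment> \<open>Dividing each function by its integral makes the arithmetic-geometric bound
      integrate to \<open>\<alpha> + \<beta> + \<gamma> = 1\<close>; \<open>C\<close> collects the
      factors taken out.\<close>
    define C where "C = a powr \<alpha> * b powr \<beta> * c powr \<gamma>"
    have ptw: "F x powr \<alpha> * G x powr \<beta> * H x powr \<gamma>
        \<le> C * (\<alpha> * (F x / a) + \<beta> * (G x / b) + \<gamma> * (H x / c))" for x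
    proof -
      have "F x powr \<alpha> * G x powr \<beta> * H x powr \<gamma>
          = C * ((F x / a) powr \<alpha> * (G x / b) powr \<beta> * (H x / c) powr \<gamma>)"
        using pos nonneg by (simp add: C_def powr_divide)
      also have "\<dots> \<le> C * (\<alpha> * (F x / a) + \<beta> * (G x / b) + \<gamma> * (H x / c))"
        using pos nonneg exps by (intro mult_left_mono weighted_am_gm3) (auto simp: C_def)
      finally show ?thesis .
    qed
    have "(\<integral>x. F x powr \<alpha> * G x powr \<beta> * H x powr \<gamma> \<partial>M)
        \<le> (\<integral>x. C * (\<alpha> * (F x / a) + \<beta> * (G x / b) + \<gamma> * (H x / c)) \<partial>M)"
      using int by (intro integral_mono * ptw) auto
    also have "\<dots> = C * (\<alpha> * (a / a) + \<beta> * (b / b) + \<gamma> * (c / c))"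
      using int by (simp add: a_def b_def c_def)
    also have "\<dots> = C"
      using pos exps by simp
    finally show ?thesis
      by (simp add: C_def a_def b_def c_def)
  qed
qed

section \<open>Essential suprema, nesting of Lebesgue spaces and extended exponents\<close>

lemma Lp_space_infinity_AE:
  assumes "f \<in> Lp_space M \<infinity>"
  shows "AE x in M. \<bar>f x\<bar> \<le> Lp_norm M \<infinity> f"
proof -
  let ?s = "esssup M (\<lambda>x. ereal \<bar>f x\<bar>)"
  have fin: "?s < \<infinity>"
    using assms by (simp add: Lp_space_def)
  have "AE x in M. ereal \<bar>f x\<bar> \<le> ?s"
    by (rule esssup_AE)
  then show ?thesis
  proof eventually_elim
    case (elim x)
    then show ?case
      \<comment> \<open>Besides real values, \<open>fin\<close> leaves only
        \<open>-\<infinity>\<close>, which cannot bound \<open>\<bar>f x\<bar>\<close>; so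
        \<open>real_of_ereal\<close> loses nothing.\<close>
      using fin by (cases ?s) (auto simp: Lp_norm_def)
  qed
qed

lemma Lp_infinityI:
  assumes meas [measurable]: "f \<in> borel_measurable M"
    and le: "AE x in M. \<bar>f x\<bar> \<le> C" and "0 \<le> C"
  shows "f \<in> Lp_space M \<infinity>" and "Lp_norm M \<infinity> f \<le> C"
proof -
  let ?s = "esssup M (\<lambda>x. ereal \<bar>f x\<bar>)"
  have "?s \<le> ereal C"
    using le by (intro esssup_I) auto
  \<comment> \<open>If \<open>?s\<close> is \<open>-\<infinity>\<close>, as for a null measure, the
    norm is 0 by the convention of \<open>real_of_ereal\<close>; then \<open>0 \<le> C\<close> gives
    the bound.\<close>
  then show "f \<in> Lp_space M \<infinity>" "Lp_norm M \<infinity> f \<le> C"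
    using \<open>0 \<le> C\<close> by (cases ?s; auto simp: Lp_space_def Lp_norm_def)+
qed

text \<open>\<open>esssup\<close> takes the value \<open>top\<close> on nonmeasurable functions, so
  measurability is carried over together with the values.\<close>

lemma esssup_cong:
  assumes "\<And>x. x \<in> space M \<Longrightarrow> f x = g x"
  shows "esssup M f = esssup M g"
  using measurable_cong[of M f g borel, OF assms]
  by (auto simp: esssup_def assms intro!: Limsup_eq AE_I2)

text \<open>Used for \<open>kernel_convolution\<close>, which is shown to agree with an integral
  against \<open>weighted \<sigma> W\<close> only on the space of the measure.\<close>

lemma
  assumes eq: "\<And>x. x \<in> space M \<Longrightarrow> f x = g x"
  shows Lp_space_cong: "f \<in> Lp_space M p \<longleftrightarrow> g \<in> Lp_space M p"
    and Lp_norm_cong: "Lp_norm M p f = Lp_norm M p g"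
proof -
  have "f \<in> borel_measurable M \<longleftrightarrow> g \<in> borel_measurable M"
    by (rule measurable_cong[OF eq])
  moreover have "esssup M (\<lambda>x. ereal \<bar>f x\<bar>) = esssup M (\<lambda>x. ereal \<bar>g x\<bar>)"
    by (rule esssup_cong) (simp add: eq)
  moreover have "integrable M (\<lambda>x. \<bar>f x\<bar> powr s) \<longleftrightarrow> integrable M (\<lambda>x. \<bar>g x\<bar> powr s)"
    and "(\<integral>x. \<bar>f x\<bar> powr s \<partial>M) = (\<integral>x. \<bar>g x\<bar> powr s \<partial>M)" for s
    by (auto simp: eq intro!: Bochner_Integration.integrable_cong Bochner_Integration.integral_cong)
  ultimately show "f \<in> Lp_space M p \<longleftrightarrow> g \<in> Lp_space M p" "Lp_norm M p f = Lp_norm M p g"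
    by (simp_all add: Lp_space_def Lp_norm_def)
qed

lemma Lp_norm_one: "Lp_norm M 1 f = (\<integral>x. \<bar>f x\<bar> \<partial>M)"
  by (simp add: Lp_norm_def)

lemma (in prob_space) integrable_Lp_space:
  assumes "f \<in> Lp_space M p" and "1 \<le> p"
  shows "integrable M f"
proof (cases "p = \<infinity>")
  case True
  then show ?thesis
    using assms Lp_space_infinity_AE[of f M]
    by (intro integrable_const_bound[where B = "Lp_norm M \<infinity> f"]) (auto simp: Lp_space_def)
next
  case False
  define s where "s = real_of_ereal p"
  have s: "1 \<le> s"
    using False assms(2) unfolding s_def by (cases p) auto
  have f [measurable]: "f \<in> borel_measurable M" and int: "integrable M (\<lambda>x. \<bar>f x\<bar> powr s)"
    using assms False by (auto simp: Lp_space_def s_def)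
  \<comment> \<open>Finite total mass enters here: it makes the constant 1 integrable.\<close>
  have le: "\<bar>f x\<bar> \<le> 1 + \<bar>f x\<bar> powr s" for x
  proof (cases "\<bar>f x\<bar> \<le> 1")
    case False
    then show ?thesis
      using powr_mono[of 1 s "\<bar>f x\<bar>"] s by simp
  qed (smt (verit) powr_ge_zero)
  show ?thesis
  proof (rule Bochner_Integration.integrable_bound)
    show "integrable M (\<lambda>x. 1 + \<bar>f x\<bar> powr s)"
      using int by auto
    show "AE x in M. norm (f x) \<le> norm (1 + \<bar>f x\<bar> powr s)"
      using le by (auto intro!: AE_I2 order_trans[OF le])
  qed measurable
qed

text \<open>The left side of the relation is nonnegative and the right side is at most 0, so both
  vanish. This is the exponent relation that remains when \<open>q\<close> or \<open>r\<close> is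
  infinite.\<close>

lemma conjugate_exponent_infinity:
  fixes p s :: ereal
  assumes "1 \<le> p" "1 \<le> s" and eq: "inverse p = inverse s - 1"
  shows "s = 1" "p = \<infinity>"
proof -
  obtain b where b: "inverse s = ereal b" "b \<le> 1" "b = 1 \<Longrightarrow> s = 1"
  proof (cases s)
    case (real r)
    then show thesis
      using assms(2) that[of "inverse r"] by (auto simp: field_simps)
  qed (use assms(2) that[of 0] in auto)
  obtain a where a: "inverse p = ereal a" "0 \<le> a" "a = 0 \<Longrightarrow> p = \<infinity>"
  proof (cases p)
    case (real r)
    then show thesis
      using assms(1) that[of "inverse r"] by (auto simp: field_simps)
  qed (use assms(1) that[of 0] in auto)
  have "a = b - 1"
    using eq by (simp add: a b one_ereal_def)
  then show "s = 1" "p = \<infinity>"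
    using a b by auto
qed

section \<open>Young's inequality for a measure-transporting kernel\<close>

text \<open>All that Young's inequality takes from the addition formula, with no polynomials left:
  \<open>transport\<close> corresponds to translation invariance on a group, and
  \<open>symmetric\<close> to invariance under inversion.\<close>

locale symmetric_transport =
  M: prob_space M + T: prob_space \<tau> + N: prob_space N
  for M :: "'a measure" and \<tau> :: "'u measure" and N :: "real measure"
    and \<xi> :: "'a \<Rightarrow> 'a \<Rightarrow> 'u \<Rightarrow> real" +
  assumes measurable_\<xi> [measurable]: "(\<lambda>(x, y, u). \<xi> x y u) \<in> measurable (M \<Otimes>\<^sub>M M \<Otimes>\<^sub>M \<tau>) N"
    and symmetric: "x \<in> space M \<Longrightarrow> y \<in> space M \<Longrightarrow> u \<in> space \<tau> \<Longrightarrow> \<xi> x y u = \<xi> y x u"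
    and transport: "x \<in> space M \<Longrightarrow> distr (M \<Otimes>\<^sub>M \<tau>) N (\<lambda>(y, u). \<xi> x y u) = N"
begin

sublocale MT: pair_prob_space M \<tau> ..
sublocale MM: pair_prob_space M M ..
sublocale M_MT: pair_prob_space M "M \<Otimes>\<^sub>M \<tau>" ..

section \<open>Change of variables and Fubini along the kernel\<close>

lemma measurable_section:
  assumes "x \<in> space M"
  shows "(\<lambda>(y, u). \<xi> x y u) \<in> measurable (M \<Otimes>\<^sub>M \<tau>) N"
  using measurable_compose[OF measurable_Pair1'[OF assms] measurable_\<xi>]
  by (simp add: case_prod_beta')

lemma measurable_section' [measurable (raw)]:
  assumes "f \<in> measurable L M" "g \<in> measurable L M" "h \<in> measurable L \<tau>"
  shows "(\<lambda>z. \<xi> (f z) (g z) (h z)) \<in> measurable L N"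
  using measurable_compose[OF _ measurable_\<xi>, of "\<lambda>z. (f z, g z, h z)" L] assms by simp

lemma
  fixes g :: "real \<Rightarrow> real"
  assumes x: "x \<in> space M" and g [measurable]: "g \<in> borel_measurable N"
  shows integrable_section: "integrable N g \<Longrightarrow> integrable (M \<Otimes>\<^sub>M \<tau>) (\<lambda>(y, u). g (\<xi> x y u))"
    and integral_section: "(\<integral>(y, u). g (\<xi> x y u) \<partial>(M \<Otimes>\<^sub>M \<tau>)) = (\<integral>t. g t \<partial>N)"
  using integrable_distr_eq[OF measurable_section[OF x] g] integral_distr[OF measurable_section[OF x] g]
  by (simp_all add: transport[OF x, unfolded case_prod_beta'] case_prod_beta')

lemma nn_integral_section:
  assumes x: "x \<in> space M" and h: "h \<in> borel_measurable N"
  shows "(\<integral>\<^sup>+y. \<integral>\<^sup>+u. h (\<xi> x y u) \<partial>\<tau> \<partial>M) = (\<integral>\<^sup>+t. h t \<partial>N)"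
proof -
  note [measurable] = h x
  have "(\<integral>\<^sup>+y. \<integral>\<^sup>+u. h (\<xi> x y u) \<partial>\<tau> \<partial>M) = (\<integral>\<^sup>+(y, u). h (\<xi> x y u) \<partial>(M \<Otimes>\<^sub>M \<tau>))"
    by (subst T.nn_integral_fst[symmetric]) auto
  also have "\<dots> = (\<integral>\<^sup>+t. h t \<partial>distr (M \<Otimes>\<^sub>M \<tau>) N (\<lambda>(y, u). \<xi> x y u))"
    by (subst nn_integral_distr) (auto simp: case_prod_beta')
  finally show ?thesis
    by (simp add: transport[OF x])
qed

text \<open>Null sets of \<open>N\<close> pull back to null sets, so an essential bound on
  \<open>g\<close> survives composition with \<open>\<xi> x\<close>.\<close>

lemma AE_section:
  assumes x: "x \<in> space M" and ae: "AE t in N. P t"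
  shows "AE (y, u) in M \<Otimes>\<^sub>M \<tau>. P (\<xi> x y u)"
proof -
  have "AE t in distr (M \<Otimes>\<^sub>M \<tau>) N (\<lambda>(y, u). \<xi> x y u). P t"
    unfolding transport[OF x] by (rule ae)
  then show ?thesis
    using AE_distrD[OF measurable_section[OF x]] by (simp add: case_prod_beta')
qed

text \<open>\<open>transport\<close> integrates out the second argument of \<open>\<xi>\<close>, but
  here \<open>f\<close> depends on that argument. After interchanging the outer integrals,
  \<open>symmetric\<close> moves \<open>y\<close> into the first slot, and \<open>transport\<close>
  applies at \<open>y\<close>.\<close>

lemma nn_integral_triple:
  assumes f [measurable]: "f \<in> borel_measurable M" and h [measurable]: "h \<in> borel_measurable N"
  shows "(\<integral>\<^sup>+(x, y, u). f y * h (\<xi> x y u) \<partial>(M \<Otimes>\<^sub>M M \<Otimes>\<^sub>M \<tau>)) = (\<integral>\<^sup>+y. f y \<partial>M) * (\<integral>\<^sup>+t. h t \<partial>N)"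
proof -
  have "(\<integral>\<^sup>+(x, y, u). f y * h (\<xi> x y u) \<partial>(M \<Otimes>\<^sub>M M \<Otimes>\<^sub>M \<tau>))
      = (\<integral>\<^sup>+x. \<integral>\<^sup>+(y, u). f y * h (\<xi> x y u) \<partial>(M \<Otimes>\<^sub>M \<tau>) \<partial>M)"
    by (subst MT.nn_integral_fst[symmetric]) auto
  also have "\<dots> = (\<integral>\<^sup>+x. \<integral>\<^sup>+y. \<integral>\<^sup>+u. f y * h (\<xi> x y u) \<partial>\<tau> \<partial>M \<partial>M)"
    by (intro nn_integral_cong, subst T.nn_integral_fst[symmetric]) auto
  also have "\<dots> = (\<integral>\<^sup>+y. \<integral>\<^sup>+x. \<integral>\<^sup>+u. f y * h (\<xi> x y u) \<partial>\<tau> \<partial>M \<partial>M)"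
    by (rule MM.Fubini'[symmetric]) auto
  also have "\<dots> = (\<integral>\<^sup>+y. \<integral>\<^sup>+x. f y * (\<integral>\<^sup>+u. h (\<xi> y x u) \<partial>\<tau>) \<partial>M \<partial>M)"
    by (intro nn_integral_cong) (auto simp: nn_integral_cmult symmetric cong: nn_integral_cong)
  also have "\<dots> = (\<integral>\<^sup>+y. f y * (\<integral>\<^sup>+t. h t \<partial>N) \<partial>M)"
    by (intro nn_integral_cong) (subst nn_integral_cmult, auto simp: nn_integral_section)
  finally show ?thesis
    by (simp add: nn_integral_multc)
qed

lemma
  fixes f :: "'a \<Rightarrow> real" and h :: "real \<Rightarrow> real"
  assumes f: "integrable M f" "\<And>y. 0 \<le> f y" and h: "integrable N h" "\<And>t. 0 \<le> h t"
  shows integrable_triple: "integrable (M \<Otimes>\<^sub>M M \<Otimes>\<^sub>M \<tau>) (\<lambda>(x, y, u). f y * h (\<xi> x y u))"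
    and integral_triple: "(\<integral>(x, y, u). f y * h (\<xi> x y u) \<partial>(M \<Otimes>\<^sub>M M \<Otimes>\<^sub>M \<tau>)) = (\<integral>y. f y \<partial>M) * (\<integral>t. h t \<partial>N)"
proof -
  have [measurable]: "f \<in> borel_measurable M" "h \<in> borel_measurable N"
    using f h by auto
  have "(\<integral>\<^sup>+z. ennreal (case z of (x, y, u) \<Rightarrow> f y * h (\<xi> x y u)) \<partial>(M \<Otimes>\<^sub>M M \<Otimes>\<^sub>M \<tau>))
      = (\<integral>\<^sup>+(x, y, u). ennreal (f y) * ennreal (h (\<xi> x y u)) \<partial>(M \<Otimes>\<^sub>M M \<Otimes>\<^sub>M \<tau>))"
    using f h by (intro nn_integral_cong) (auto simp: ennreal_mult split: prod.split)
  also have "\<dots> = ennreal ((\<integral>y. f y \<partial>M) * (\<integral>t. h t \<partial>N))"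
    using f h by (subst nn_integral_triple) (auto simp: nn_integral_eq_integral ennreal_mult)
  finally have *: "(\<integral>\<^sup>+z. ennreal (case z of (x, y, u) \<Rightarrow> f y * h (\<xi> x y u)) \<partial>(M \<Otimes>\<^sub>M M \<Otimes>\<^sub>M \<tau>))
      = ennreal ((\<integral>y. f y \<partial>M) * (\<integral>t. h t \<partial>N))" .
  have "has_bochner_integral (M \<Otimes>\<^sub>M M \<Otimes>\<^sub>M \<tau>) (\<lambda>(x, y, u). f y * h (\<xi> x y u))
      ((\<integral>y. f y \<partial>M) * (\<integral>t. h t \<partial>N))"
    using f h by (intro has_bochner_integral_nn_integral[OF _ _ _ *]) auto
  then show "integrable (M \<Otimes>\<^sub>M M \<Otimes>\<^sub>M \<tau>) (\<lambda>(x, y, u). f y * h (\<xi> x y u))"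
    and "(\<integral>(x, y, u). f y * h (\<xi> x y u) \<partial>(M \<Otimes>\<^sub>M M \<Otimes>\<^sub>M \<tau>)) = (\<integral>y. f y \<partial>M) * (\<integral>t. h t \<partial>N)"
    by (auto simp: has_bochner_integral_iff)
qed

lemma measurable_convolution:
  fixes f :: "'a \<Rightarrow> real" and g :: "real \<Rightarrow> real"
  assumes [measurable]: "f \<in> borel_measurable M" "g \<in> borel_measurable N"
  shows "(\<lambda>x. \<integral>y. f y * T_op \<xi> \<tau> g x y \<partial>M) \<in> borel_measurable M"
  unfolding T_op_def by measurable

text \<open>Fubini turns integrability on the product into convergence of the inner integral for
  almost every \<open>y\<close>, the first half of \<open>convolution_exists\<close>.\<close>

lemma AE_integrable_T_op:
  fixes g :: "real \<Rightarrow> real"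
  assumes "x \<in> space M" "integrable N g"
  shows "AE y in M. integrable \<tau> (\<lambda>u. g (\<xi> x y u))"
  using MT.AE_integrable_fst'[OF integrable_section[OF assms(1) _ assms(2)]] assms(2) by simp

lemma
  fixes f :: "'a \<Rightarrow> real" and g :: "real \<Rightarrow> real"
  assumes int: "integrable (M \<Otimes>\<^sub>M \<tau>) (\<lambda>(y, u). f y * g (\<xi> x y u))"
  shows integrable_convolution: "integrable M (\<lambda>y. f y * T_op \<xi> \<tau> g x y)"
    and convolution_le: "\<bar>\<integral>y. f y * T_op \<xi> \<tau> g x y \<partial>M\<bar> \<le> (\<integral>(y, u). \<bar>f y\<bar> * \<bar>g (\<xi> x y u)\<bar> \<partial>(M \<Otimes>\<^sub>M \<tau>))"
proof -
  show "integrable M (\<lambda>y. f y * T_op \<xi> \<tau> g x y)"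
    using MT.integrable_fst'[OF int] by (simp add: T_op_def)
  have "(\<integral>y. f y * T_op \<xi> \<tau> g x y \<partial>M) = (\<integral>z. (case z of (y, u) \<Rightarrow> f y * g (\<xi> x y u)) \<partial>(M \<Otimes>\<^sub>M \<tau>))"
    using MT.integral_fst'[OF int] by (simp add: T_op_def)
  also have "\<bar>\<dots>\<bar> \<le> (\<integral>z. \<bar>case z of (y, u) \<Rightarrow> f y * g (\<xi> x y u)\<bar> \<partial>(M \<Otimes>\<^sub>M \<tau>))"
    by (rule integral_abs_bound)
  finally show "\<bar>\<integral>y. f y * T_op \<xi> \<tau> g x y \<partial>M\<bar> \<le> (\<integral>(y, u). \<bar>f y\<bar> * \<bar>g (\<xi> x y u)\<bar> \<partial>(M \<Otimes>\<^sub>M \<tau>))"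
    by (simp add: case_prod_beta' abs_mult)
qed

text \<open>
  With \<open>\<alpha> = 1 / p\<close>, factor \<open>\<bar>f\<bar> \<bar>g\<bar>\<close> as
  \<open>(\<bar>f\<bar>\<^sup>q \<bar>g\<bar>\<^sup>r)\<close> to the power \<open>\<alpha>\<close>, times \<open>\<bar>f\<bar>\<^sup>q\<close> to the power \<open>1 / q - \<alpha>\<close>, times
  \<open>\<bar>g\<bar>\<^sup>r\<close> to the power \<open>1 / r - \<alpha>\<close>.
\<close>

lemma convolution_bound:
  fixes f :: "'a \<Rightarrow> real" and g :: "real \<Rightarrow> real" and q r \<alpha> :: real
  assumes f [measurable]: "f \<in> borel_measurable M" and g [measurable]: "g \<in> borel_measurable N"
    and int_f: "integrable M (\<lambda>y. \<bar>f y\<bar> powr q)" and int_g: "integrable N (\<lambda>t. \<bar>g t\<bar> powr r)"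
    and q: "1 \<le> q" and r: "1 \<le> r" and \<alpha>: "0 \<le> \<alpha>" "\<alpha> = 1 / q + 1 / r - 1"
    and x: "x \<in> space M"
    and int: "integrable (M \<Otimes>\<^sub>M \<tau>) (\<lambda>(y, u). \<bar>f y\<bar> powr q * \<bar>g (\<xi> x y u)\<bar> powr r)"
  shows "integrable M (\<lambda>y. f y * T_op \<xi> \<tau> g x y)"
    and "\<bar>\<integral>y. f y * T_op \<xi> \<tau> g x y \<partial>M\<bar>
      \<le> (\<integral>(y, u). \<bar>f y\<bar> powr q * \<bar>g (\<xi> x y u)\<bar> powr r \<partial>(M \<Otimes>\<^sub>M \<tau>)) powr \<alpha> *
        (\<integral>y. \<bar>f y\<bar> powr q \<partial>M) powr (1 / q - \<alpha>) * (\<integral>t. \<bar>g t\<bar> powr r \<partial>N) powr (1 / r - \<alpha>)"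
proof -
  note [measurable] = x
  define F G H where "F = (\<lambda>(y, u). \<bar>f y\<bar> powr q * \<bar>g (\<xi> x y u)\<bar> powr r)"
    and "G = (\<lambda>(y, u::'u). \<bar>f y\<bar> powr q)" and "H = (\<lambda>(y, u). \<bar>g (\<xi> x y u)\<bar> powr r)"
  \<comment> \<open>\<open>\<tau>\<close> has mass one, so a function of \<open>y\<close> alone
    keeps its integral on the product.\<close>
  have distrG: "distr (M \<Otimes>\<^sub>M \<tau>) M fst = M"
    by (simp add: T.distr_pair_fst)
  have G: "integrable (M \<Otimes>\<^sub>M \<tau>) G" "(\<integral>z. G z \<partial>(M \<Otimes>\<^sub>M \<tau>)) = (\<integral>y. \<bar>f y\<bar> powr q \<partial>M)"
    using integrable_distr_eq[of fst "M \<Otimes>\<^sub>M \<tau>" M "\<lambda>y. \<bar>f y\<bar> powr q"] int_f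
      integral_distr[of fst "M \<Otimes>\<^sub>M \<tau>" M "\<lambda>y. \<bar>f y\<bar> powr q"]
    unfolding G_def distrG by (auto simp: case_prod_beta')
  have H: "integrable (M \<Otimes>\<^sub>M \<tau>) H" "(\<integral>z. H z \<partial>(M \<Otimes>\<^sub>M \<tau>)) = (\<integral>t. \<bar>g t\<bar> powr r \<partial>N)"
    using integrable_section[OF x _ int_g] integral_section[OF x, of "\<lambda>t. \<bar>g t\<bar> powr r"]
    unfolding H_def by auto
  have F: "integrable (M \<Otimes>\<^sub>M \<tau>) F"
    using int by (simp add: F_def)
  have nonneg: "F z \<ge> 0" "G z \<ge> 0" "H z \<ge> 0" for z
    by (auto simp: F_def G_def H_def split: prod.split)
  \<comment> \<open>The last two exponents are \<open>1 - 1 / r\<close> and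
    \<open>1 - 1 / q\<close>.\<close>
  have exps: "0 \<le> 1 / q - \<alpha>" "0 \<le> 1 / r - \<alpha>" "\<alpha> + (1 / q - \<alpha>) + (1 / r - \<alpha>) = 1"
    using q r \<alpha> by auto
  have eq: "F z powr \<alpha> * G z powr (1 / q - \<alpha>) * H z powr (1 / r - \<alpha>)
      = (case z of (y, u) \<Rightarrow> \<bar>f y\<bar> * \<bar>g (\<xi> x y u)\<bar>)" for z
  proof -
    have *: "(s powr q * t powr r) powr \<alpha> * (s powr q) powr (1 / q - \<alpha>) * (t powr r) powr (1 / r - \<alpha>) = s * t"
      if "0 \<le> s" "0 \<le> t" for s t :: real
    proof -
      have "(s powr q * t powr r) powr \<alpha> * (s powr q) powr (1 / q - \<alpha>) * (t powr r) powr (1 / r - \<alpha>)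
          = s powr (q * \<alpha> + q * (1 / q - \<alpha>)) * t powr (r * \<alpha> + r * (1 / r - \<alpha>))"
        using that by (simp add: powr_mult powr_powr powr_add)
      also have "q * \<alpha> + q * (1 / q - \<alpha>) = 1"
        using q by (simp add: field_simps)
      also have "r * \<alpha> + r * (1 / r - \<alpha>) = 1"
        using r by (simp add: field_simps)
      finally show ?thesis
        using that by simp
    qed
    show ?thesis
      by (auto simp: F_def G_def H_def * split: prod.split)
  qed
  note hoelder = Hoelder3[OF F G(1) H(1) nonneg \<alpha>(1) exps, unfolded eq]
  have int_abs: "integrable (M \<Otimes>\<^sub>M \<tau>) (\<lambda>(y, u). f y * g (\<xi> x y u))"
    by (rule Bochner_Integration.integrable_bound[OF hoelder(1)]) (auto simp: abs_mult)
  show "integrable M (\<lambda>y. f y * T_op \<xi> \<tau> g x y)"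
    by (rule integrable_convolution[OF int_abs])
  show "\<bar>\<integral>y. f y * T_op \<xi> \<tau> g x y \<partial>M\<bar>
      \<le> (\<integral>(y, u). \<bar>f y\<bar> powr q * \<bar>g (\<xi> x y u)\<bar> powr r \<partial>(M \<Otimes>\<^sub>M \<tau>)) powr \<alpha> *
        (\<integral>y. \<bar>f y\<bar> powr q \<partial>M) powr (1 / q - \<alpha>) * (\<integral>t. \<bar>g t\<bar> powr r \<partial>N) powr (1 / r - \<alpha>)"
    using order_trans[OF convolution_le[OF int_abs] hoelder(2)] unfolding G(2) H(2) F_def .
qed

section \<open>Young's inequality, by cases on the exponents\<close>

lemma Young_finite:
  fixes f :: "'a \<Rightarrow> real" and g :: "real \<Rightarrow> real" and q r :: real and p :: ereal
  assumes f: "f \<in> Lp_space M (ereal q)" and g: "g \<in> Lp_space N (ereal r)"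
    and p: "1 \<le> p" and q: "1 \<le> q" and r: "1 \<le> r"
    and pqr: "inverse p = ereal (1 / r + 1 / q - 1)"
  defines "c \<equiv> \<lambda>x. \<integral>y. f y * T_op \<xi> \<tau> g x y \<partial>M"
  shows "AE x in M. integrable M (\<lambda>y. f y * T_op \<xi> \<tau> g x y)"
    and "c \<in> Lp_space M p"
    and "Lp_norm M p c \<le> Lp_norm M (ereal q) f * Lp_norm N (ereal r) g"
proof -
  define \<alpha> where "\<alpha> = 1 / q + 1 / r - 1"
  have p\<alpha>: "inverse p = ereal \<alpha>"
    using pqr by (simp add: \<alpha>_def)
  have \<alpha>: "0 \<le> \<alpha>"
    using p p\<alpha> by (cases p) auto
  have f_meas [measurable]: "f \<in> borel_measurable M" and int_f: "integrable M (\<lambda>y. \<bar>f y\<bar> powr q)"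
    using f by (auto simp: Lp_space_def)
  have g_meas [measurable]: "g \<in> borel_measurable N" and int_g: "integrable N (\<lambda>t. \<bar>g t\<bar> powr r)"
    using g by (auto simp: Lp_space_def)
  have c_meas [measurable]: "c \<in> borel_measurable M"
    unfolding c_def by (rule measurable_convolution) auto
  define A B where "A = (\<integral>y. \<bar>f y\<bar> powr q \<partial>M)" and "B = (\<integral>t. \<bar>g t\<bar> powr r \<partial>N)"
  \<comment> \<open>\<open>I x\<close> is the only factor in \<open>convolution_bound\<close> that
    varies with \<open>x\<close>; by \<open>integral_triple\<close> its integral splits as
    \<open>A * B\<close>.\<close>
  define I where "I = (\<lambda>x. \<integral>(y, u). \<bar>f y\<bar> powr q * \<bar>g (\<xi> x y u)\<bar> powr r \<partial>(M \<Otimes>\<^sub>M \<tau>))"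
  have AB: "0 \<le> A" "0 \<le> B"
    by (auto simp: A_def B_def)
  have norms: "Lp_norm M (ereal q) f = A powr (1 / q)" "Lp_norm N (ereal r) g = B powr (1 / r)"
    by (auto simp: Lp_norm_def A_def B_def)
  have int3: "integrable (M \<Otimes>\<^sub>M M \<Otimes>\<^sub>M \<tau>) (\<lambda>(x, y, u). \<bar>f y\<bar> powr q * \<bar>g (\<xi> x y u)\<bar> powr r)"
    using integrable_triple[OF int_f _ int_g] by simp
  have int_I: "integrable M I"
    using M_MT.integrable_fst'[OF int3] by (simp add: I_def case_prod_beta')
  have integral_I: "(\<integral>x. I x \<partial>M) = A * B"
    using M_MT.integral_fst'[OF int3] integral_triple[OF int_f _ int_g]
    by (simp add: I_def A_def B_def case_prod_beta')
  have I_nonneg: "0 \<le> I x" for x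
    by (auto simp: I_def intro!: integral_nonneg_AE)
  \<comment> \<open>\<open>convolution_bound\<close> applies only where the section of
    \<open>int3\<close> is integrable, which Fubini grants almost everywhere.\<close>
  have "AE x in M. integrable (M \<Otimes>\<^sub>M \<tau>) (\<lambda>(y, u). \<bar>f y\<bar> powr q * \<bar>g (\<xi> x y u)\<bar> powr r)"
    using M_MT.AE_integrable_fst'[OF int3] by simp
  then have both: "AE x in M. integrable M (\<lambda>y. f y * T_op \<xi> \<tau> g x y) \<and>
      \<bar>c x\<bar> \<le> I x powr \<alpha> * A powr (1 / q - \<alpha>) * B powr (1 / r - \<alpha>)"
    using AE_space
  proof eventually_elim
    case (elim x)
    show ?case
      using convolution_bound[OF f_meas g_meas int_f int_g q r \<alpha> \<alpha>_def elim(2,1)]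
      by (simp add: c_def I_def A_def B_def)
  qed
  then show "AE x in M. integrable M (\<lambda>y. f y * T_op \<xi> \<tau> g x y)"
    by auto
  have bound: "AE x in M. \<bar>c x\<bar> \<le> I x powr \<alpha> * A powr (1 / q - \<alpha>) * B powr (1 / r - \<alpha>)"
    using both by auto
  show "c \<in> Lp_space M p" and "Lp_norm M p c \<le> Lp_norm M (ereal q) f * Lp_norm N (ereal r) g"
  proof -
    have "c \<in> Lp_space M p \<and> Lp_norm M p c \<le> A powr (1 / q) * B powr (1 / r)"
    proof (cases "p = \<infinity>")
      case True
      then have "\<alpha> = 0"
        using p\<alpha> by (simp add: zero_ereal_def)
      have "AE x in M. \<bar>c x\<bar> \<le> A powr (1 / q) * B powr (1 / r)"
        using bound
      proof eventually_elim
        case (elim x)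
        \<comment> \<open>\<open>I x powr 0\<close> is 1 or, if \<open>I x = 0\<close>, 0.\<close>
        also have "I x powr \<alpha> * A powr (1 / q - \<alpha>) * B powr (1 / r - \<alpha>) \<le> 1 * A powr (1 / q) * B powr (1 / r)"
          unfolding \<open>\<alpha> = 0\<close> by (intro mult_mono) auto
        finally show ?case
          by simp
      qed
      then show ?thesis
        unfolding True by (intro conjI Lp_infinityI) auto
    next
      case False
      then obtain s where ps: "p = ereal s"
        using p by (cases p) auto
      then have s: "1 \<le> s" "\<alpha> = 1 / s"
        using p p\<alpha> by (auto simp: inverse_eq_divide)
      \<comment> \<open>Raising the bound to the power \<open>s = 1 / \<alpha>\<close> turns
        \<open>1 / q - \<alpha>\<close> and \<open>1 / r - \<alpha>\<close> into these exponents and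
        gives \<open>I x\<close> exponent 1.\<close>
      define C where "C = A powr (s / q - 1) * B powr (s / r - 1)"
      have le: "AE x in M. \<bar>c x\<bar> powr s \<le> C * I x"
        using bound
      proof eventually_elim
        case (elim x)
        then have "\<bar>c x\<bar> powr s \<le> (I x powr \<alpha> * A powr (1 / q - \<alpha>) * B powr (1 / r - \<alpha>)) powr s"
          using s by (intro powr_mono2) auto
        also have "\<dots> = I x powr (\<alpha> * s) * A powr ((1 / q - \<alpha>) * s) * B powr ((1 / r - \<alpha>) * s)"
          by (simp add: powr_mult powr_powr)
        also have "\<dots> = C * I x"
          using s I_nonneg[of x] by (simp add: C_def algebra_simps)
        finally show ?case .
      qed
      have int_c: "integrable M (\<lambda>x. \<bar>c x\<bar> powr s)"
        by (rule Bochner_Integration.integrable_bound[OF integrable_mult_right[OF int_I, of C]])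
          (use le in \<open>auto elim!: eventually_mono\<close>)
      then have "c \<in> Lp_space M p"
        by (simp add: Lp_space_def ps)
      moreover have "(\<integral>x. \<bar>c x\<bar> powr s \<partial>M) \<le> A powr (s / q) * B powr (s / r)"
      proof -
        have "(\<integral>x. \<bar>c x\<bar> powr s \<partial>M) \<le> (\<integral>x. C * I x \<partial>M)"
          using int_I int_c le by (intro integral_mono_AE) auto
        \<comment> \<open>\<open>powr_add\<close> holds for base 0 too, so writing \<open>A\<close>
          and \<open>B\<close> as powers with exponent 1 avoids a case split on vanishing
          norms.\<close>
        also have "\<dots> = (A powr (s / q - 1) * A powr 1) * (B powr (s / r - 1) * B powr 1)"
          using AB by (simp add: integral_I C_def)
        also have "\<dots> = A powr (s / q) * B powr (s / r)"
          by (simp only: powr_add[symmetric] diff_add_cancel)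
        finally show ?thesis .
      qed
      then have "(\<integral>x. \<bar>c x\<bar> powr s \<partial>M) powr (1 / s) \<le> (A powr (s / q) * B powr (s / r)) powr (1 / s)"
        using s by (intro powr_mono2) auto
      then have "Lp_norm M p c \<le> A powr (1 / q) * B powr (1 / r)"
        using s by (simp add: ps Lp_norm_def powr_mult powr_powr)
      ultimately show ?thesis
        by simp
    qed
    then show "c \<in> Lp_space M p" "Lp_norm M p c \<le> Lp_norm M (ereal q) f * Lp_norm N (ereal r) g"
      by (auto simp: norms)
  qed
qed

text \<open>Common end of the cases where \<open>f\<close> or \<open>g\<close> is only essentially
  bounded: a bound on the double integral, uniform in \<open>x\<close>, suffices when
  \<open>p\<close> is infinite.\<close>

lemma Young_infinity:
  fixes f :: "'a \<Rightarrow> real" and g :: "real \<Rightarrow> real"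
  assumes f [measurable]: "f \<in> borel_measurable M" and g [measurable]: "g \<in> borel_measurable N"
    and B: "0 \<le> B" and bound: "\<And>x. x \<in> space M \<Longrightarrow>
        integrable (M \<Otimes>\<^sub>M \<tau>) (\<lambda>(y, u). f y * g (\<xi> x y u)) \<and>
        (\<integral>(y, u). \<bar>f y\<bar> * \<bar>g (\<xi> x y u)\<bar> \<partial>(M \<Otimes>\<^sub>M \<tau>)) \<le> B"
  shows "AE x in M. integrable M (\<lambda>y. f y * T_op \<xi> \<tau> g x y)"
    and "(\<lambda>x. \<integral>y. f y * T_op \<xi> \<tau> g x y \<partial>M) \<in> Lp_space M \<infinity>"
    and "Lp_norm M \<infinity> (\<lambda>x. \<integral>y. f y * T_op \<xi> \<tau> g x y \<partial>M) \<le> B"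
proof -
  show "AE x in M. integrable M (\<lambda>y. f y * T_op \<xi> \<tau> g x y)"
    using bound by (auto intro!: AE_I2 integrable_convolution)
  have "AE x in M. \<bar>\<integral>y. f y * T_op \<xi> \<tau> g x y \<partial>M\<bar> \<le> B"
    using bound by (auto intro!: AE_I2 order_trans[OF convolution_le])
  from Lp_infinityI[OF measurable_convolution[OF f g] this B]
  show "(\<lambda>x. \<integral>y. f y * T_op \<xi> \<tau> g x y \<partial>M) \<in> Lp_space M \<infinity>"
    and "Lp_norm M \<infinity> (\<lambda>x. \<integral>y. f y * T_op \<xi> \<tau> g x y \<partial>M) \<le> B" .
qed

lemma Young:
  fixes f :: "'a \<Rightarrow> real" and g :: "real \<Rightarrow> real" and p q r :: ereal
  assumes f: "f \<in> Lp_space M q" and g: "g \<in> Lp_space N r"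
    and p: "1 \<le> p" and q: "1 \<le> q" and r: "1 \<le> r"
    and pqr: "inverse p = inverse r + inverse q - 1"
  defines "c \<equiv> \<lambda>x. \<integral>y. f y * T_op \<xi> \<tau> g x y \<partial>M"
  shows "AE x in M. integrable M (\<lambda>y. f y * T_op \<xi> \<tau> g x y)"
    and "c \<in> Lp_space M p"
    and "Lp_norm M p c \<le> Lp_norm M q f * Lp_norm N r g"
proof -
  have f_meas [measurable]: "f \<in> borel_measurable M" and int_f: "integrable M f"
    using f M.integrable_Lp_space[OF f q] by (auto simp: Lp_space_def)
  have g_meas [measurable]: "g \<in> borel_measurable N" and int_g: "integrable N g"
    using g N.integrable_Lp_space[OF g r] by (auto simp: Lp_space_def)
  have "(AE x in M. integrable M (\<lambda>y. f y * T_op \<xi> \<tau> g x y)) \<and> c \<in> Lp_space M p \<and>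
      Lp_norm M p c \<le> Lp_norm M q f * Lp_norm N r g"
  proof -
    \<comment> \<open>An infinite \<open>p\<close> with finite \<open>q\<close> and \<open>r\<close>
      belongs to the first case, where \<open>Young_finite\<close> runs with
      \<open>\<alpha> = 0\<close>.\<close>
    consider (finite) q' r' where "q = ereal q'" "r = ereal r'"
      | (f_bounded) "q = \<infinity>" "r = 1" "p = \<infinity>" | (g_bounded) "r = \<infinity>" "q = 1" "p = \<infinity>"
    proof -
      consider "q = \<infinity>" | "r = \<infinity>" | "\<bar>q\<bar> \<noteq> \<infinity>" "\<bar>r\<bar> \<noteq> \<infinity>"
        using q r by (cases q; cases r) auto
      then show thesis
      proof cases
        case 1
        then have "inverse p = inverse r - 1"
          using pqr by simp
        then show thesis
          using that(2) 1 conjugate_exponent_infinity[OF p r] by simp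
      next
        case 2
        then have "inverse p = inverse q - 1"
          using pqr by simp
        then show thesis
          using that(3) 2 conjugate_exponent_infinity[OF p q] by simp
      next
        case 3
        then show thesis
          using that(1) 3 by (cases q; cases r) auto
      qed
    qed
    then show ?thesis
    proof cases
      case finite
      have "inverse p = ereal (1 / r' + 1 / q' - 1)"
        using pqr q r finite by (simp add: one_ereal_def inverse_eq_divide)
      with Young_finite[of f q' g r' p] f g p q r show ?thesis
        unfolding finite c_def by simp
    next
      case f_bounded
      let ?K = "Lp_norm M \<infinity> f"
      have ae: "AE y in M. \<bar>f y\<bar> \<le> ?K"
        using f f_bounded by (intro Lp_space_infinity_AE) simp
      \<comment> \<open>A probability measure is not null, so the essential bound holds at some
        point, and this makes \<open>?K\<close> nonnegative.\<close>
      obtain y0 where "\<bar>f y0\<bar> \<le> ?K"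
        using eventually_happens'[OF M.ae_filter_bot ae] by auto
      then have K: "0 \<le> ?K"
        by linarith
      have bound: "integrable (M \<Otimes>\<^sub>M \<tau>) (\<lambda>(y, u). f y * g (\<xi> x y u)) \<and>
        (\<integral>(y, u). \<bar>f y\<bar> * \<bar>g (\<xi> x y u)\<bar> \<partial>(M \<Otimes>\<^sub>M \<tau>)) \<le> ?K * Lp_norm N 1 g" if x: "x \<in> space M" for x
      proof -
        note [measurable] = x
        have ae2: "AE z in M \<Otimes>\<^sub>M \<tau>. \<bar>f (fst z)\<bar> \<le> ?K"
          using ae by (intro MT.AE_pair_measure) auto
        have int: "integrable (M \<Otimes>\<^sub>M \<tau>) (\<lambda>(y, u). ?K * \<bar>g (\<xi> x y u)\<bar>)"
          using integrable_section[OF x, of "\<lambda>t. ?K * \<bar>g t\<bar>"] int_g by auto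
        have le: "AE z in M \<Otimes>\<^sub>M \<tau>. (case z of (y, u) \<Rightarrow> \<bar>f y\<bar> * \<bar>g (\<xi> x y u)\<bar>)
            \<le> (case z of (y, u) \<Rightarrow> ?K * \<bar>g (\<xi> x y u)\<bar>)"
          using ae2 by eventually_elim (auto intro!: mult_right_mono split: prod.splits)
        have int1: "integrable (M \<Otimes>\<^sub>M \<tau>) (\<lambda>(y, u). f y * g (\<xi> x y u))"
          by (rule Bochner_Integration.integrable_bound[OF int])
            (use le K in \<open>auto elim!: eventually_mono simp: abs_mult\<close>)
        then have "integrable (M \<Otimes>\<^sub>M \<tau>) (\<lambda>(y, u). \<bar>f y\<bar> * \<bar>g (\<xi> x y u)\<bar>)"
          using integrable_abs[OF int1] by (simp add: case_prod_beta' abs_mult)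
        then have "(\<integral>(y, u). \<bar>f y\<bar> * \<bar>g (\<xi> x y u)\<bar> \<partial>(M \<Otimes>\<^sub>M \<tau>))
            \<le> (\<integral>(y, u). ?K * \<bar>g (\<xi> x y u)\<bar> \<partial>(M \<Otimes>\<^sub>M \<tau>))"
          using int le by (intro integral_mono_AE)
        then show ?thesis
          using int1 integral_section[OF x, of "\<lambda>t. ?K * \<bar>g t\<bar>"] by (simp add: Lp_norm_one)
      qed
      have "0 \<le> ?K * Lp_norm N 1 g"
        using K by (simp add: Lp_norm_one)
      from Young_infinity[OF f_meas g_meas this bound] show ?thesis
        unfolding f_bounded c_def by simp
    next
      case g_bounded
      let ?K = "Lp_norm N \<infinity> g"
      have ae: "AE t in N. \<bar>g t\<bar> \<le> ?K"
        using g g_bounded by (intro Lp_space_infinity_AE) simp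
      obtain t0 where "\<bar>g t0\<bar> \<le> ?K"
        using eventually_happens'[OF N.ae_filter_bot ae] by auto
      then have K: "0 \<le> ?K"
        by linarith
      have distr_fst: "distr (M \<Otimes>\<^sub>M \<tau>) M fst = M"
        by (simp add: T.distr_pair_fst)
      have bound: "integrable (M \<Otimes>\<^sub>M \<tau>) (\<lambda>(y, u). f y * g (\<xi> x y u)) \<and>
        (\<integral>(y, u). \<bar>f y\<bar> * \<bar>g (\<xi> x y u)\<bar> \<partial>(M \<Otimes>\<^sub>M \<tau>)) \<le> Lp_norm M 1 f * ?K" if x: "x \<in> space M" for x
      proof -
        note [measurable] = x
        have int: "integrable (M \<Otimes>\<^sub>M \<tau>) (\<lambda>(y, u). \<bar>f y\<bar> * ?K)"
          using integrable_distr_eq[of fst "M \<Otimes>\<^sub>M \<tau>" M "\<lambda>y. \<bar>f y\<bar> * ?K"] int_f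
          unfolding distr_fst by (auto simp: case_prod_beta')
        have integral: "(\<integral>(y, u). \<bar>f y\<bar> * ?K \<partial>(M \<Otimes>\<^sub>M \<tau>)) = Lp_norm M 1 f * ?K"
          using integral_distr[of fst "M \<Otimes>\<^sub>M \<tau>" M "\<lambda>y. \<bar>f y\<bar> * ?K"]
          unfolding distr_fst by (auto simp: case_prod_beta' Lp_norm_one)
        have le: "AE z in M \<Otimes>\<^sub>M \<tau>. (case z of (y, u) \<Rightarrow> \<bar>f y\<bar> * \<bar>g (\<xi> x y u)\<bar>)
            \<le> (case z of (y, u) \<Rightarrow> \<bar>f y\<bar> * ?K)"
          using AE_section[OF x ae] by eventually_elim (auto intro!: mult_left_mono split: prod.splits)
        have int1: "integrable (M \<Otimes>\<^sub>M \<tau>) (\<lambda>(y, u). f y * g (\<xi> x y u))"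
          by (rule Bochner_Integration.integrable_bound[OF int])
            (use le K in \<open>auto elim!: eventually_mono simp: abs_mult\<close>)
        then have "integrable (M \<Otimes>\<^sub>M \<tau>) (\<lambda>(y, u). \<bar>f y\<bar> * \<bar>g (\<xi> x y u)\<bar>)"
          using integrable_abs[OF int1] by (simp add: case_prod_beta' abs_mult)
        then have "(\<integral>(y, u). \<bar>f y\<bar> * \<bar>g (\<xi> x y u)\<bar> \<partial>(M \<Otimes>\<^sub>M \<tau>))
            \<le> (\<integral>(y, u). \<bar>f y\<bar> * ?K \<partial>(M \<Otimes>\<^sub>M \<tau>))"
          using int le by (intro integral_mono_AE)
        then show ?thesis
          using int1 integral by simp
      qed
      have "0 \<le> Lp_norm M 1 f * ?K"
        using K by (simp add: Lp_norm_one)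
      from Young_infinity[OF f_meas g_meas this bound] show ?thesis
        unfolding g_bounded c_def by simp
    qed
  qed
  then show "AE x in M. integrable M (\<lambda>y. f y * T_op \<xi> \<tau> g x y)"
    and "c \<in> Lp_space M p"
    and "Lp_norm M p c \<le> Lp_norm M q f * Lp_norm N r g"
    by auto
qed

end

section \<open>The image measure under an addition formula\<close>

lemma continuous_on_interval_bounded:
  fixes f :: "real \<Rightarrow> real"
  assumes "continuous_on {a..b} f"
  obtains B where "\<And>x. x \<in> {a..b} \<Longrightarrow> norm (f x) \<le> B"
proof -
  have "bounded (f ` {a..b})"
    using assms by (intro compact_imp_bounded compact_continuous_image) auto
  then obtain B where "\<forall>y \<in> f ` {a..b}. norm y \<le> B"
    by (auto simp: bounded_iff)
  then show thesis
    by (intro that[of B]) auto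
qed

lemma integrable_bounded_interval:
  fixes f :: "real \<Rightarrow> real"
  assumes "real_distribution \<nu>" and "AE x in \<nu>. x \<in> {-1..1}" and "continuous_on UNIV f"
  shows "integrable \<nu> f"
proof -
  interpret real_distribution \<nu> by fact
  obtain B where "\<And>x. x \<in> {-1..1} \<Longrightarrow> norm (f x) \<le> B"
    using assms(3) by (rule continuous_on_interval_bounded[OF continuous_on_subset]) auto
  then have "AE x in \<nu>. norm (f x) \<le> B"
    using assms(2) by (auto elim: eventually_mono)
  moreover have "f \<in> borel_measurable \<nu>"
    using borel_measurable_continuous_onI[OF assms(3)] by simp
  ultimately show ?thesis
    by (intro integrable_const_bound) auto
qed

text \<open>Both measures are carried by [-1, 1], so uniform approximation of \<open>f\<close> by
  polynomials there controls both integrals.\<close>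

lemma integral_eq_if_moments_eq:
  fixes f :: "real \<Rightarrow> real"
  assumes \<nu>1: "real_distribution \<nu>1" "AE x in \<nu>1. x \<in> {-1..1}"
    and \<nu>2: "real_distribution \<nu>2" "AE x in \<nu>2. x \<in> {-1..1}"
    and moments: "\<And>q. (\<integral>x. poly q x \<partial>\<nu>1) = (\<integral>x. poly q x \<partial>\<nu>2)"
    and f: "continuous_on UNIV f"
  shows "(\<integral>x. f x \<partial>\<nu>1) = (\<integral>x. f x \<partial>\<nu>2)"
proof -
  have close: "\<bar>(\<integral>x. f x \<partial>\<nu>) - (\<integral>x. poly q x \<partial>\<nu>)\<bar> \<le> e"
    if \<nu>: "real_distribution \<nu>" "AE x in \<nu>. x \<in> {-1..1}"
      and q: "\<And>x. x \<in> {-1..1} \<Longrightarrow> \<bar>f x - poly q x\<bar> < e" for \<nu> q e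
  proof -
    interpret real_distribution \<nu> by fact
    have int: "integrable \<nu> f" "integrable \<nu> (poly q)"
      by (intro integrable_bounded_interval \<nu> f continuous_intros)+
    have "\<bar>\<integral>x. f x - poly q x \<partial>\<nu>\<bar> \<le> (\<integral>x. \<bar>f x - poly q x\<bar> \<partial>\<nu>)"
      by (rule integral_abs_bound)
    also have "\<dots> \<le> (\<integral>x. e \<partial>\<nu>)"
    proof (intro integral_mono_AE)
      show "AE x in \<nu>. \<bar>f x - poly q x\<bar> \<le> e"
        using \<nu>(2) by eventually_elim (use q in \<open>auto intro: less_imp_le\<close>)
    qed (use int in auto)
    finally show ?thesis
      using int prob_space by simp
  qed
  \<comment> \<open>The shape \<open>0 + e\<close> is the one that \<open>field_le_epsilon\<close>
    expects.\<close>
  have "\<bar>(\<integral>x. f x \<partial>\<nu>1) - (\<integral>x. f x \<partial>\<nu>2)\<bar> \<le> 0 + e" if e: "e > 0" for e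
  proof -
    obtain g where g: "real_polynomial_function g" "\<And>x. x \<in> {-1..1} \<Longrightarrow> \<bar>f x - g x\<bar> < e / 2"
      using Stone_Weierstrass_real_polynomial_function[of "{-1..1::real}" f "e / 2"] e f
      by (auto intro: continuous_on_subset)
    then obtain a n where "g = (\<lambda>x. \<Sum>i\<le>n. a i * x ^ i)"
      using real_polynomial_function_imp_sum by blast
    then have "g = poly (\<Sum>i\<le>n. monom (a i) i)"
      by (auto simp: poly_sum poly_monom)
    then show ?thesis
      using close[OF \<nu>1, of "\<Sum>i\<le>n. monom (a i) i" "e / 2"]
        close[OF \<nu>2, of "\<Sum>i\<le>n. monom (a i) i" "e / 2"] g(2) moments
      by (smt (verit) field_sum_of_halves)
  qed
  then have "\<bar>(\<integral>x. f x \<partial>\<nu>1) - (\<integral>x. f x \<partial>\<nu>2)\<bar> \<le> 0"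
    by (rule field_le_epsilon)
  then show ?thesis
    by simp
qed

text \<open>The real and imaginary parts of a characteristic function are integrals of cosines and
  sines, continuous functions to which \<open>integral_eq_if_moments_eq\<close> applies.\<close>

lemma real_distribution_eq_if_moments_eq:
  assumes \<nu>1: "real_distribution \<nu>1" "AE x in \<nu>1. x \<in> {-1..1}"
    and \<nu>2: "real_distribution \<nu>2" "AE x in \<nu>2. x \<in> {-1..1}"
    and moments: "\<And>q. (\<integral>x. poly q x \<partial>\<nu>1) = (\<integral>x. poly q x \<partial>\<nu>2)"
  shows "\<nu>1 = \<nu>2"
proof (rule Levy_uniqueness)
  note eq = integral_eq_if_moments_eq[OF \<nu>1 \<nu>2 moments]
  have char: "char \<nu> t = Complex (\<integral>x. cos (t * x) \<partial>\<nu>) (\<integral>x. sin (t * x) \<partial>\<nu>)"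
    if \<nu>: "real_distribution \<nu>" for \<nu> t
  proof -
    interpret real_distribution \<nu> by fact
    have int: "integrable \<nu> (\<lambda>x. iexp (t * x))"
      by (rule integrable_iexp) auto
    show ?thesis
      using integral_Re[OF int] integral_Im[OF int]
      by (auto simp: char_def complex_eq_iff Re_exp Im_exp)
  qed
  show "char \<nu>1 = char \<nu>2"
    by (rule ext) (simp add: char \<nu>1 \<nu>2 eq continuous_intros)
qed (use assms in auto)

text \<open>One polynomial of each degree spans all polynomials: subtracting a multiple of
  \<open>p (degree q)\<close> cancels the leading term of \<open>q\<close>.\<close>

lemma integral_poly_eq_if_graded:
  fixes p :: "nat \<Rightarrow> real poly"
  assumes \<nu>1: "real_distribution \<nu>1" "AE x in \<nu>1. x \<in> {-1..1}"
    and \<nu>2: "real_distribution \<nu>2" "AE x in \<nu>2. x \<in> {-1..1}"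
    and p: "\<And>n. p n \<noteq> 0" "\<And>n. degree (p n) = n"
    and eq: "\<And>n. (\<integral>x. poly (p n) x \<partial>\<nu>1) = (\<integral>x. poly (p n) x \<partial>\<nu>2)"
  shows "(\<integral>x. poly q x \<partial>\<nu>1) = (\<integral>x. poly q x \<partial>\<nu>2)"
proof (induction "degree q" arbitrary: q rule: less_induct)
  case less
  define c where "c = lead_coeff q / lead_coeff (p (degree q))"
  define q' where "q' = q - smult c (p (degree q))"
  have int: "integrable \<nu>1 (poly q)" "integrable \<nu>2 (poly q)" for q
    by (intro integrable_bounded_interval \<nu>1 \<nu>2 continuous_intros)+
  have coeff: "coeff q' (degree q) = 0"
    using p[of "degree q"] leading_coeff_neq_0[of "p (degree q)"] by (simp add: q'_def c_def)
  have deg: "degree q' \<le> degree q"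
    unfolding q'_def using p by (intro degree_diff_le) (auto intro: order_trans[OF degree_smult_le])
  have "(\<integral>x. poly q' x \<partial>\<nu>1) = (\<integral>x. poly q' x \<partial>\<nu>2)"
  \<comment> \<open>For constant \<open>q\<close> the remainder is 0 and its degree does not drop,
    so the induction hypothesis would not apply.\<close>
  proof (cases "q' = 0")
    case False
    then have "degree q' < degree q"
      using coeff deg leading_coeff_neq_0[of q'] by (metis le_neq_implies_less)
    then show ?thesis
      by (rule less)
  qed simp
  moreover have "(\<integral>x. poly q x \<partial>\<nu>) = (\<integral>x. poly q' x \<partial>\<nu>) + c * (\<integral>x. poly (p (degree q)) x \<partial>\<nu>)"
    if "\<nu> = \<nu>1 \<or> \<nu> = \<nu>2" for \<nu>
    using that int by (auto simp: q'_def)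
  ultimately show ?case
    by (simp add: eq)
qed

section \<open>Measures given by a density of mass one\<close>

lemma weighted_props:
  assumes "unit_weight \<sigma> W"
  shows space_weighted: "space (weighted \<sigma> W) = space \<sigma>"
    and sets_weighted: "sets (weighted \<sigma> W) = sets \<sigma>"
    and prob_space_weighted: "prob_space (weighted \<sigma> W)"
proof -
  have nonneg: "AE x in \<sigma>. 0 \<le> W x" and int: "integrable \<sigma> W" "(\<integral>x. W x \<partial>\<sigma>) = 1"
    using assms by (auto simp: unit_weight_def has_bochner_integral_iff)
  then have "(\<integral>\<^sup>+x. ennreal (W x) \<partial>\<sigma>) = 1"
    by (simp add: nn_integral_eq_integral)
  then show "prob_space (weighted \<sigma> W)"
    using int(1) by (intro prob_spaceI) (simp add: weighted_def emeasure_density cong: nn_integral_cong)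
qed (auto simp: weighted_def)

lemma
  fixes f :: "'a \<Rightarrow> real"
  assumes "unit_weight \<sigma> W" and "f \<in> borel_measurable \<sigma>"
  shows integral_weighted: "(\<integral>x. f x \<partial>weighted \<sigma> W) = (\<integral>x. f x * W x \<partial>\<sigma>)"
    and integrable_weighted_iff: "integrable (weighted \<sigma> W) f \<longleftrightarrow> integrable \<sigma> (\<lambda>x. f x * W x)"
proof -
  have "AE x in \<sigma>. 0 \<le> W x" "W \<in> borel_measurable \<sigma>"
    using assms by (auto simp: unit_weight_def has_bochner_integral_iff)
  then show "(\<integral>x. f x \<partial>weighted \<sigma> W) = (\<integral>x. f x * W x \<partial>\<sigma>)"
    and "integrable (weighted \<sigma> W) f \<longleftrightarrow> integrable \<sigma> (\<lambda>x. f x * W x)"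
    unfolding weighted_def using assms(2)
    by (simp_all add: integral_density integrable_density mult.commute)
qed

section \<open>Orthogonal polynomials in one variable\<close>

lemma measurable_poly_11 [measurable]: "poly (q :: real poly) \<in> borel_measurable lborel_11"
  by (intro measurable_restrict_space1, simp, intro borel_measurable_continuous_onI continuous_intros)

context
  fixes \<omega> :: "real \<Rightarrow> real"
  assumes \<omega>: "unit_weight lborel_11 \<omega>"
begin

interpretation prob_space "weighted lborel_11 \<omega>"
  by (rule prob_space_weighted[OF \<omega>])

lemma weighted_inner_poly:
  "weighted_inner lborel_11 \<omega> (poly p) (poly q) = (\<integral>t. poly p t * poly q t \<partial>weighted lborel_11 \<omega>)"
  unfolding weighted_inner_def by (intro integral_weighted[symmetric] \<omega>) measurable

text \<open>The finitely many roots form a Lebesgue null set, hence a null set for the density;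
  vanishing almost everywhere would make a measure of mass one null.\<close>

lemma not_AE_poly_eq_0:
  fixes q :: "real poly"
  assumes "q \<noteq> 0"
  shows "\<not> (AE t in weighted lborel_11 \<omega>. poly q t = 0)"
proof
  assume "AE t in weighted lborel_11 \<omega>. poly q t = 0"
  moreover have "AE t in weighted lborel_11 \<omega>. poly q t \<noteq> 0"
  proof -
    have "AE t in lborel. t \<notin> {t. poly q t = 0}"
      using poly_roots_finite[OF assms] by (intro AE_not_in finite_imp_null_set_lborel)
    then have "AE t in lborel_11. poly q t \<noteq> 0"
      by (auto simp: AE_restrict_space_iff elim!: eventually_mono)
    moreover have "\<omega> \<in> borel_measurable lborel_11"
      using \<omega> by (auto simp: unit_weight_def has_bochner_integral_iff)
    ultimately show ?thesis
      unfolding weighted_def by (subst AE_density) auto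
  qed
  ultimately have "AE t in weighted lborel_11 \<omega>. False"
    by eventually_elim simp
  then show False
    by simp
qed

text \<open>The factor \<open>w\<close> allows two uses: \<open>w = 1\<close> for the norm of an
  orthogonal polynomial, and \<open>w\<close> with values 1 - t for its value at 1.\<close>

lemma weighted_inner_poly_eq_0D:
  fixes w q :: "real poly"
  assumes "\<And>t. t \<in> {-1..1} \<Longrightarrow> 0 \<le> poly w t" and "w \<noteq> 0"
    and "(\<integral>t. poly w t * (poly q t)\<^sup>2 \<partial>weighted lborel_11 \<omega>) = 0"
  shows "q = 0"
proof (rule ccontr)
  assume "q \<noteq> 0"
  have sp: "space (weighted lborel_11 \<omega>) = {-1..1}"
    using \<omega> by (simp add: space_weighted space_restrict_space)
  have [measurable_cong]: "sets (weighted lborel_11 \<omega>) = sets lborel_11"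
    by (rule sets_weighted[OF \<omega>])
  have int: "integrable (weighted lborel_11 \<omega>) (poly p)" for p :: "real poly"
  proof -
    obtain B where "\<And>x. x \<in> {-1..1} \<Longrightarrow> norm (poly p x) \<le> B"
      by (rule continuous_on_interval_bounded[of "-1" 1 "poly p"]) (auto intro!: continuous_intros)
    then show ?thesis
      by (intro integrable_const_bound[where B = B]) (auto simp: sp)
  qed
  have "AE t in weighted lborel_11 \<omega>. poly w t * (poly q t)\<^sup>2 = 0"
  proof (subst integral_nonneg_eq_0_iff_AE[symmetric])
    show "integrable (weighted lborel_11 \<omega>) (\<lambda>t. poly w t * (poly q t)\<^sup>2)"
      using int[of "w * q\<^sup>2"] by (simp add: poly_mult[abs_def] poly_power[abs_def])
  qed (use assms in \<open>auto simp: sp intro!: AE_I2\<close>)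
  then have "AE t in weighted lborel_11 \<omega>. poly (w * q\<^sup>2) t = 0"
    by simp
  then show False
    using not_AE_poly_eq_0[of "w * q\<^sup>2"] \<open>w \<noteq> 0\<close> \<open>q \<noteq> 0\<close> by simp
qed

text \<open>If \<open>p\<close> has the root 1, its cofactor \<open>q\<close> has smaller degree and
  is orthogonal to \<open>p\<close>, so the integral of (t - 1) times the square of \<open>q\<close>
  vanishes. Up to sign that integrand is nonnegative on [-1, 1], which forces
  \<open>q = 0\<close>.\<close>

lemma orthogonal_poly_at_1:
  assumes "orthogonal_poly \<omega> n p"
  shows "poly p 1 \<noteq> 0"
proof
  assume "poly p 1 = 0"
  then obtain q where q: "p = [:-1, 1:] * q"
    by (metis dvdE poly_eq_0_iff_dvd)
  have p: "p \<noteq> 0" "degree p = n"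
    "\<And>q. degree q < n \<Longrightarrow> (\<integral>t. poly p t * poly q t \<partial>weighted lborel_11 \<omega>) = 0"
    using assms by (auto simp: orthogonal_poly_def weighted_inner_poly)
  then have "q \<noteq> 0"
    by (auto simp: q)
  then have "degree p = Suc (degree q)"
    unfolding q by (subst degree_mult_eq) auto
  then have "(\<integral>t. poly p t * poly q t \<partial>weighted lborel_11 \<omega>) = 0"
    using p by auto
  then have "(\<integral>t. - (poly [:1, -1:] t * (poly q t)\<^sup>2) \<partial>weighted lborel_11 \<omega>) = 0"
    by (simp add: q algebra_simps power2_eq_square)
  then have "q = 0"
    using weighted_inner_poly_eq_0D[of "[:1, -1:]" q] by simp
  with \<open>q \<noteq> 0\<close> show False ..
qed

text \<open>Division by zero gives 0, so a vanishing norm would turn \<open>zonal\<close> into the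
  zero function.\<close>

lemma orthogonal_poly_norm:
  assumes "orthogonal_poly \<omega> n p"
  shows "weighted_inner lborel_11 \<omega> (poly p) (poly p) \<noteq> 0"
  using weighted_inner_poly_eq_0D[of 1 p] assms
  by (auto simp: orthogonal_poly_def weighted_inner_poly power2_eq_square)

lemma integral_zonal:
  assumes p: "orthogonal_poly \<omega> n p"
  shows "(\<integral>t. zonal \<omega> p t \<partial>weighted lborel_11 \<omega>) = (if n = 0 then 1 else 0)"
proof (cases "n = 0")
  case True
  then obtain c where c: "p = [:c:]"
    using p degree_eq_zeroE unfolding orthogonal_poly_def by blast
  have "c \<noteq> 0"
    using p by (auto simp: orthogonal_poly_def c)
  then show ?thesis
    using True prob_space by (simp add: zonal_def weighted_inner_poly c)
next
  case False
  then have "weighted_inner lborel_11 \<omega> (poly p) (poly 1) = 0"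
    using p by (auto simp: orthogonal_poly_def)
  then show ?thesis
    using False by (simp add: zonal_def weighted_inner_poly)
qed

end

section \<open>Constants and the reproducing kernels\<close>

lemma one_in_polynomials_upto: "(\<lambda>_ :: real ^ 'd. 1) \<in> polynomials_upto n"
proof -
  \<comment> \<open>A sum over an infinite index set would be 0 by default, so evaluating the sum at
    the zero multi-index requires finiteness.\<close>
  have fin: "finite {\<alpha> :: 'd \<Rightarrow> nat. sum \<alpha> UNIV \<le> n}"
  proof (rule finite_subset)
    show "{\<alpha> :: 'd \<Rightarrow> nat. sum \<alpha> UNIV \<le> n} \<subseteq> (UNIV :: 'd set) \<rightarrow>\<^sub>E {..n}"
    proof
      fix \<alpha> :: "'d \<Rightarrow> nat"
      assume "\<alpha> \<in> {\<alpha>. sum \<alpha> UNIV \<le> n}"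
      then have "\<alpha> i \<le> n" for i
        using member_le_sum[of i UNIV \<alpha>] by simp
      then show "\<alpha> \<in> UNIV \<rightarrow>\<^sub>E {..n}"
        by (simp add: PiE_UNIV_domain)
    qed
  qed (simp add: finite_PiE)
  have "(\<Sum>\<alpha> | sum \<alpha> UNIV \<le> n. (if \<alpha> = (\<lambda>_. 0) then 1 else 0) * (\<Prod>i\<in>UNIV. (x $ i) ^ \<alpha> i)) = 1"
    for x :: "real ^ 'd"
  proof -
    have "(\<Sum>\<alpha> | sum \<alpha> UNIV \<le> n. (if \<alpha> = (\<lambda>_. 0) then 1 else 0) * (\<Prod>i\<in>UNIV. (x $ i) ^ \<alpha> i))
        = (\<Sum>\<alpha> | sum \<alpha> (UNIV :: 'd set) \<le> n. if \<alpha> = (\<lambda>_. 0) then 1 else 0)"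
      by (intro sum.cong) auto
    also have "\<dots> = 1"
      using fin by (simp add: sum.delta)
    finally show ?thesis .
  qed
  then show ?thesis
    unfolding polynomials_upto_def
    by (intro CollectI exI[of _ "\<lambda>\<alpha>. if \<alpha> = (\<lambda>_. 0) then 1 else 0"]) (simp add: fun_eq_iff)
qed

lemma one_in_orthogonal_polynomials: "(\<lambda>_. 1) \<in> orthogonal_polynomials \<sigma> W 0"
  by (simp add: orthogonal_polynomials_def one_in_polynomials_upto)

text \<open>In degree 0 the constant 1 is itself reproduced; in positive degree the kernel is
  orthogonal to it. The values are those of \<open>integral_zonal\<close>, and this match turns the
  addition formula into an equality of moments.\<close>

lemma integral_reproducing_kernel:
  assumes "reproducing_kernel \<sigma> W n K" and x: "x \<in> space \<sigma>"
  shows "(\<integral>y. K x y * W y \<partial>\<sigma>) = (if n = 0 then 1 else 0)"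
proof -
  obtain P where P: "P \<in> orthogonal_polynomials \<sigma> W n" "\<And>y. y \<in> space \<sigma> \<Longrightarrow> K x y = P y"
    and rep: "\<And>Q. Q \<in> orthogonal_polynomials \<sigma> W n \<Longrightarrow> weighted_inner \<sigma> W (K x) Q = Q x"
    using assms by (auto simp: reproducing_kernel_def)
  have "(\<integral>y. K x y * W y \<partial>\<sigma>) = weighted_inner \<sigma> W (K x) (\<lambda>_. 1)"
    by (simp add: weighted_inner_def)
  also have "\<dots> = (if n = 0 then 1 else 0)"
  proof (cases "n = 0")
    case True
    then show ?thesis
      using rep[of "\<lambda>_. 1", unfolded True, OF one_in_orthogonal_polynomials] by simp
  next
    case False
    have "weighted_inner \<sigma> W (K x) (\<lambda>_. 1) = weighted_inner \<sigma> W P (\<lambda>_. 1)"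
      unfolding weighted_inner_def using P(2) by (intro Bochner_Integration.integral_cong) auto
    also have "\<dots> = 0"
      using P(1) False one_in_polynomials_upto[of 0] by (auto simp: orthogonal_polynomials_def)
    finally show ?thesis
      using False by simp
  qed
  finally show ?thesis .
qed

lemma addition_formula_transport:
  fixes \<sigma> :: "(real ^ 'd) measure" and \<xi> :: "real ^ 'd \<Rightarrow> real ^ 'd \<Rightarrow> real ^ 'm \<Rightarrow> real"
  assumes W: "unit_weight \<sigma> W" and K: "\<And>n. reproducing_kernel \<sigma> W n (K n)"
    and add: "addition_formula \<sigma> K \<omega> \<xi> \<tau>" and x: "x \<in> space \<sigma>"
  shows "distr (weighted \<sigma> W \<Otimes>\<^sub>M \<tau>) (weighted lborel_11 \<omega>) (\<lambda>(y, u). \<xi> x y u) = weighted lborel_11 \<omega>"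
proof -
  let ?M = "weighted \<sigma> W" and ?N = "weighted lborel_11 \<omega>"
  have \<omega>: "unit_weight lborel_11 \<omega>" and \<tau>: "prob_space \<tau>" "space \<tau> = cube"
    and \<xi>_meas: "(\<lambda>(x, y, u). \<xi> x y u) \<in> borel_measurable (\<sigma> \<Otimes>\<^sub>M \<sigma> \<Otimes>\<^sub>M \<tau>)"
    and \<xi>_range: "\<And>y u. y \<in> space \<sigma> \<Longrightarrow> u \<in> cube \<Longrightarrow> \<xi> x y u \<in> {-1..1}"
    using add x by (auto simp: addition_formula_def)
  obtain p where p: "\<And>n. orthogonal_poly \<omega> n (p n)"
    and Kp: "\<And>n y. y \<in> space \<sigma> \<Longrightarrow> K n x y = (\<integral>u. zonal \<omega> (p n) (\<xi> x y u) \<partial>\<tau>)"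
    using add x unfolding addition_formula_def by blast
  interpret M: prob_space ?M by (rule prob_space_weighted[OF W])
  interpret N: prob_space ?N by (rule prob_space_weighted[OF \<omega>])
  interpret T: prob_space \<tau> by (rule \<tau>)
  interpret MT: pair_prob_space ?M \<tau> ..
  have [measurable_cong]: "sets ?M = sets \<sigma>"
    by (rule sets_weighted[OF W])
  have sp: "space ?M = space \<sigma>" "space ?N = {-1..1}"
    using W \<omega> by (simp_all add: space_weighted space_restrict_space)
  have sets_N: "sets ?N = sets (restrict_space borel {-1..1})"
    using sets_weighted[OF \<omega>] sets_restrict_space_cong[of lborel borel] by simp
  have sect [measurable]: "(\<lambda>(y, u). \<xi> x y u) \<in> borel_measurable (?M \<Otimes>\<^sub>M \<tau>)"
    using measurable_compose[OF measurable_Pair1'[OF x] \<xi>_meas] by (simp add: case_prod_beta')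
  have sect_N: "(\<lambda>(y, u). \<xi> x y u) \<in> measurable (?M \<Otimes>\<^sub>M \<tau>) ?N"
    unfolding measurable_cong_sets[OF refl sets_N]
    using \<xi>_range \<tau>(2) by (intro measurable_restrict_space2 sect) (auto simp: space_pair_measure sp)
  have id_N: "(\<lambda>t. t) \<in> measurable ?N borel"
    unfolding measurable_cong_sets[OF sets_N refl] by (intro measurable_restrict_space1) simp
  \<comment> \<open>Both measures are moved to the whole Borel line, as
    \<open>real_distribution\<close> and the uniqueness theorem for characteristic functions
    require.\<close>
  define \<nu>1 where "\<nu>1 = distr (?M \<Otimes>\<^sub>M \<tau>) borel (\<lambda>(y, u). \<xi> x y u)"
  define \<nu>2 where "\<nu>2 = distr ?N borel (\<lambda>t. t)"
  have \<nu>1: "real_distribution \<nu>1" "AE t in \<nu>1. t \<in> {-1..1}"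
    unfolding \<nu>1_def using \<xi>_range \<tau>(2) sect
    by (auto simp: AE_distr_iff space_pair_measure sp intro!: AE_I2)
  have \<nu>2: "real_distribution \<nu>2" "AE t in \<nu>2. t \<in> {-1..1}"
    unfolding \<nu>2_def using id_N AE_space[of ?N] by (auto simp: AE_distr_iff sp)
  have poly_meas: "poly q \<in> borel_measurable borel" for q :: "real poly"
    by (intro borel_measurable_continuous_onI continuous_intros)
  have zonal_eq: "zonal \<omega> (p n) =
      poly (smult (poly (p n) 1 / weighted_inner lborel_11 \<omega> (poly (p n)) (poly (p n))) (p n))" for n
    by (simp add: zonal_def fun_eq_iff)
  have zonal_meas: "zonal \<omega> (p n) \<in> borel_measurable borel" for n
    unfolding zonal_eq by (rule poly_meas)
  have zonal_moments: "(\<integral>t. zonal \<omega> (p n) t \<partial>\<nu>1) = (\<integral>t. zonal \<omega> (p n) t \<partial>\<nu>2)" for n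
  proof -
    note [measurable] = zonal_meas
    \<comment> \<open>Zonal functions are polynomials and \<open>\<nu>1\<close> has bounded support;
      the resulting joint integrability justifies Fubini below.\<close>
    have "integrable \<nu>1 (zonal \<omega> (p n))"
      unfolding zonal_eq by (intro integrable_bounded_interval \<nu>1 continuous_intros)
    then have int: "integrable (?M \<Otimes>\<^sub>M \<tau>) (\<lambda>(y, u). zonal \<omega> (p n) (\<xi> x y u))"
      unfolding \<nu>1_def by (subst (asm) integrable_distr_eq) (auto simp: case_prod_beta')
    have "(\<integral>t. zonal \<omega> (p n) t \<partial>\<nu>1) = (\<integral>z. (case z of (y, u) \<Rightarrow> zonal \<omega> (p n) (\<xi> x y u)) \<partial>(?M \<Otimes>\<^sub>M \<tau>))"
      unfolding \<nu>1_def by (subst integral_distr) (auto simp: case_prod_beta')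
    also have "\<dots> = (\<integral>y. \<integral>u. zonal \<omega> (p n) (\<xi> x y u) \<partial>\<tau> \<partial>?M)"
      using MT.integral_fst'[OF int] by simp
    also have "\<dots> = (\<integral>y. (\<integral>u. zonal \<omega> (p n) (\<xi> x y u) \<partial>\<tau>) * W y \<partial>\<sigma>)"
      using MT.integrable_fst'[OF int] by (intro integral_weighted[OF W]) (auto simp: sets_weighted[OF W] cong: measurable_cong_sets)
    also have "\<dots> = (\<integral>y. K n x y * W y \<partial>\<sigma>)"
      by (intro Bochner_Integration.integral_cong) (auto simp: Kp)
    also have "\<dots> = (\<integral>t. zonal \<omega> (p n) t \<partial>?N)"
      by (simp add: integral_reproducing_kernel[OF K x] integral_zonal[OF \<omega> p])
    also have "\<dots> = (\<integral>t. zonal \<omega> (p n) t \<partial>\<nu>2)"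
      unfolding \<nu>2_def by (rule integral_distr[OF id_N zonal_meas, symmetric])
    finally show ?thesis .
  qed
  \<comment> \<open>The zonal function is \<open>p n\<close> times a constant that is nonzero
    because neither \<open>poly (p n) 1\<close> nor the norm vanishes, so the constant
    cancels.\<close>
  have poly_moments: "(\<integral>t. poly (p n) t \<partial>\<nu>1) = (\<integral>t. poly (p n) t \<partial>\<nu>2)" for n
    using zonal_moments[of n] orthogonal_poly_at_1[OF \<omega> p[of n]] orthogonal_poly_norm[OF \<omega> p[of n]]
    by (simp add: zonal_def)
  have "(\<integral>t. poly q t \<partial>\<nu>1) = (\<integral>t. poly q t \<partial>\<nu>2)" for q
  proof (rule integral_poly_eq_if_graded[OF \<nu>1 \<nu>2, of p])
    show "p n \<noteq> 0" "degree (p n) = n" for n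
      using p[of n] by (auto simp: orthogonal_poly_def)
  qed (rule poly_moments)
  then have "\<nu>1 = \<nu>2"
    by (rule real_distribution_eq_if_moments_eq[OF \<nu>1 \<nu>2])
  show ?thesis
  \<comment> \<open>Back from the line to [-1, 1]: the measurable sets of \<open>?N\<close> are
    Borel sets inside the interval, on which \<open>\<nu>1\<close> and \<open>\<nu>2\<close>
    restrict to the two measures compared.\<close>
  proof (rule measure_eqI)
    fix A assume "A \<in> sets (distr (?M \<Otimes>\<^sub>M \<tau>) ?N (\<lambda>(y, u). \<xi> x y u))"
    then have A: "A \<in> sets ?N" "A \<in> sets borel"
      by (auto simp: sets_N sets_restrict_space)
    then have "emeasure (distr (?M \<Otimes>\<^sub>M \<tau>) ?N (\<lambda>(y, u). \<xi> x y u)) A = emeasure \<nu>1 A"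
      using sect sect_N by (simp add: \<nu>1_def emeasure_distr)
    also have "\<dots> = emeasure ?N A"
      unfolding \<open>\<nu>1 = \<nu>2\<close> \<nu>2_def using A id_N sets.sets_into_space[OF A(1)]
      by (simp add: emeasure_distr Int_absorb2)
    finally show "emeasure (distr (?M \<Otimes>\<^sub>M \<tau>) ?N (\<lambda>(y, u). \<xi> x y u)) A = emeasure ?N A" .
  qed simp
qed

theorem theorem6p5:
  fixes U :: "(real ^ 'd) set"
    and \<sigma> :: "(real ^ 'd) measure"
    and W :: "real ^ 'd \<Rightarrow> real"
    and K :: "nat \<Rightarrow> real ^ 'd \<Rightarrow> real ^ 'd \<Rightarrow> real"
    and \<omega> :: "real \<Rightarrow> real"
    and \<xi> :: "real ^ 'd \<Rightarrow> real ^ 'd \<Rightarrow> real ^ 'm \<Rightarrow> real"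
    and \<tau> :: "(real ^ 'm) measure"
    and p q r :: ereal
    and f :: "real ^ 'd \<Rightarrow> real"
    and g :: "real \<Rightarrow> real"
  assumes "U \<in> sets borel"
    and "volume_or_surface_measure U \<sigma>"
    and "unit_weight \<sigma> W"
    and "has_orthogonal_polynomial_basis \<sigma> W"
    and "\<And>n. reproducing_kernel \<sigma> W n (K n)"
    and "addition_formula \<sigma> K \<omega> \<xi> \<tau>"
    and "1 \<le> p" "1 \<le> q" "1 \<le> r"
    and "inverse p = inverse r + inverse q - 1"
    and "f \<in> Lp_space (weighted \<sigma> W) q"
    and "g \<in> Lp_space (weighted lborel_11 \<omega>) r"
    and "\<forall>t \<in> {-1..1}. g (- t) = g t"
  shows "(AE x in weighted \<sigma> W. convolution_exists \<sigma> W \<xi> \<tau> f g x) \<and>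
         kernel_convolution \<sigma> W \<xi> \<tau> f g \<in> Lp_space (weighted \<sigma> W) p \<and>
         Lp_norm (weighted \<sigma> W) p (kernel_convolution \<sigma> W \<xi> \<tau> f g)
           \<le> Lp_norm (weighted \<sigma> W) q f * Lp_norm (weighted lborel_11 \<omega>) r g"
proof -
  let ?M = "weighted \<sigma> W" and ?N = "weighted lborel_11 \<omega>"
  \<comment> \<open>The convolution with \<open>W\<close> absorbed into the measure, the form in
    which \<open>Young\<close> speaks of it.\<close>
  let ?c = "\<lambda>x. \<integral>y. f y * T_op \<xi> \<tau> g x y \<partial>?M"
  have \<omega>: "unit_weight lborel_11 \<omega>" and \<tau>: "prob_space \<tau>" "space \<tau> = cube"
    and \<xi>_meas: "(\<lambda>(x, y, u). \<xi> x y u) \<in> borel_measurable (\<sigma> \<Otimes>\<^sub>M \<sigma> \<Otimes>\<^sub>M \<tau>)"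
    and \<xi>_range: "\<And>x y u. x \<in> space \<sigma> \<Longrightarrow> y \<in> space \<sigma> \<Longrightarrow> u \<in> cube \<Longrightarrow> \<xi> x y u \<in> {-1..1}"
    and \<xi>_sym: "\<And>x y u. x \<in> space \<sigma> \<Longrightarrow> y \<in> space \<sigma> \<Longrightarrow> u \<in> cube \<Longrightarrow> \<xi> x y u = \<xi> y x u"
    using assms(6) by (auto simp: addition_formula_def)
  note W = \<open>unit_weight \<sigma> W\<close>
  have sets_M [measurable_cong]: "sets ?M = sets \<sigma>"
    by (rule sets_weighted[OF W])
  have sp: "space ?M = space \<sigma>"
    by (rule space_weighted[OF W])
  have sets_N: "sets ?N = sets (restrict_space borel {-1..1})"
    using sets_weighted[OF \<omega>] sets_restrict_space_cong[of lborel borel] by simp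
  interpret M: prob_space ?M
    by (rule prob_space_weighted[OF W])
  interpret N: prob_space ?N
    by (rule prob_space_weighted[OF \<omega>])
  interpret T: prob_space \<tau>
    by (rule \<tau>)
  interpret symmetric_transport ?M \<tau> ?N \<xi>
  proof
    have "(\<lambda>(x, y, u). \<xi> x y u) \<in> borel_measurable (?M \<Otimes>\<^sub>M ?M \<Otimes>\<^sub>M \<tau>)"
      using \<xi>_meas by measurable
    then show "(\<lambda>(x, y, u). \<xi> x y u) \<in> measurable (?M \<Otimes>\<^sub>M ?M \<Otimes>\<^sub>M \<tau>) ?N"
      unfolding measurable_cong_sets[OF refl sets_N]
      using \<xi>_range \<tau>(2) by (intro measurable_restrict_space2) (auto simp: space_pair_measure sp)
    show "distr (?M \<Otimes>\<^sub>M \<tau>) ?N (\<lambda>(y, u). \<xi> x y u) = ?N" if "x \<in> space ?M" for x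
      using addition_formula_transport[OF W assms(5,6)] that by (simp add: sp)
  qed (use \<xi>_sym \<tau>(2) sp in auto)
  have f: "f \<in> borel_measurable \<sigma>"
    using assms(11) by (simp add: Lp_space_def measurable_cong_sets[OF sets_M refl])
  have int_g: "integrable ?N g"
    by (rule N.integrable_Lp_space[OF assms(12,9)])
  \<comment> \<open>Moving \<open>W\<close> between integrand and measure requires the integrand
    without \<open>W\<close> to be measurable.\<close>
  have prod_meas: "(\<lambda>y. f y * T_op \<xi> \<tau> g x y) \<in> borel_measurable \<sigma>" if x: "x \<in> space ?M" for x
  proof -
    have [measurable]: "f \<in> borel_measurable ?M" "g \<in> borel_measurable ?N" "x \<in> space ?M"
      using assms(11) int_g x by (auto simp: Lp_space_def)
    have "(\<lambda>y. f y * T_op \<xi> \<tau> g x y) \<in> borel_measurable ?M"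
      unfolding T_op_def by measurable
    then show ?thesis
      by (simp add: measurable_cong_sets[OF sets_M refl])
  qed
  have conv: "kernel_convolution \<sigma> W \<xi> \<tau> f g x = ?c x" if "x \<in> space ?M" for x
    unfolding kernel_convolution_def by (rule integral_weighted[OF W prod_meas[OF that], symmetric])
  note young = Young[OF assms(11,12,7,8,9,10)]
  have "AE x in ?M. convolution_exists \<sigma> W \<xi> \<tau> f g x"
    using young(1) AE_space
  proof eventually_elim
    case (elim x)
    then show ?case
      using AE_integrable_T_op[OF elim(2) int_g] integrable_weighted_iff[OF W prod_meas[OF elim(2)]]
      by (simp add: convolution_exists_def)
  qed
  moreover have "kernel_convolution \<sigma> W \<xi> \<tau> f g \<in> Lp_space ?M p \<longleftrightarrow> ?c \<in> Lp_space ?M p"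
    by (rule Lp_space_cong[OF conv])
  moreover have "Lp_norm ?M p (kernel_convolution \<sigma> W \<xi> \<tau> f g) = Lp_norm ?M p ?c"
    by (rule Lp_norm_cong[OF conv])
  ultimately show ?thesis
    using young(2,3) by simp
qed

end
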